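(* (a) Let $B$ be a Boolean algebra and let $(X,X_0)$ be the canonical Stone 2-space of $B$. Then the function $g_B$, $g_B(a)=\{\Gamma\in X\mid a\in\Gamma\}$ for $a\in B$, is a Boolean isomorphism from $B$ onto the canonical Boolean algebra $RC(X,X_0)$ of $(X,X_0)$. The sets $RC(X,X_0)$ and $RC(X)$ coincide iff the Boolean algebra $B$ is complete. (b) There exists a bijective correspondence between the class of all, up to Boolean isomorphism, Boolean algebras and the class of all, up to S2S-isomorphism, Stone 2-spaces; namely, for every Boolean algebra $B$, the isomorphism class $[B]$ is mapped to the S2S-isomorphism class of the canonical Stone 2-space of $B$, and, conversely, for every Stone 2-space $(X,X_0)$, the class $[(X,X_0)]$ is mapped to the isomorphism class $[RC(X,X_0)]$.
   Context: Boolean algebras $(B,0,1,+,\cdot,{}^* )$ with $0=1$ are allowed. A grill of $B$ is a non-empty $\Gamma\subseteq B$ such that $0\notin\Gamma$; $a\in\Gamma$, $a\le b$ imply $b\in\Gamma$; and $a+b\in\Gamma$ implies $a\in\Gamma$ or $b\in\Gamma$. $Grills(B)$ is the set of grills and $Ult(B)\subseteq Grills(B)$ the set of ultrafilters of $B$. $RC(X)$ is the Boolean algebra of regular closed subsets ($F=\mathrm{cl}(\mathrm{int}F)$) of a space $X$ with $a+b=a\cup b$, $a^*=\mathrm{cl}(X\setminus a)$, $a\cdot b=\mathrm{cl}(\mathrm{int}(a\cap b))$, $0=\emptyset$, $1=X$. $CO(X)$ is the Boolean algebra of clopen sets. A topological pair $(X,X_0)$ is a space $X$ with a dense subspace $X_0$;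 $RC(X,X_0)=\{\mathrm{cl}_X(A)\mid A\in CO(X_0)\}$, a Boolean subalgebra of $RC(X)$. For $x\in X$, $\Gamma_{x,X_0}=\{F\in CO(X_0)\mid x\in \mathrm{cl}_X(F)\}$. A topological pair $(X,X_0)$ is a Stone 2-space if: (CS1) $X$ is $T_0$; (CS2) $X_0$ is a Stone space (compact Hausdorff zero-dimensional); (CS3) $RC(X,X_0)$ is a closed base for $X$; (S2S4) for every $\Gamma\in Grills(CO(X_0))$ there is $x\in X$ with $\Gamma=\Gamma_{x,X_0}$. Two Stone 2-spaces $(X,X_0)$, $(\widehat X,\widehat X_0)$ are S2S-isomorphic if there is a homeomorphism $f:X\to\widehat X$ with $f(X_0)=\widehat X_0$. The canonical Boolean algebra of a Stone 2-space $(X,X_0)$ is $RC(X,X_0)$. The canonical Stone 2-space of a Boolean algebra $B$ is $(X,X_0)$, where $X$ is the set of all clans of the contact algebra $(B,\rho_l^B)$ with the largest contact relation $a\rho_l^Bb$ iff ($a\neq0$ and $b\ne0$) (a clan of $(B,\rho_l^B)$ being a grill any two elements of which are $\rho_l^B$-related, so that $X=Grills(B)$), with the topology having $\{g_B(a)\mid a\in B\}$ as a closed base, and $X_0=Ult(B)$ with the subspace topology; it is a Stone 2-space. *)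

theory Defs
  imports "HOL-Analysis.Analysis" "HOL-Algebra.Complete_Lattice" "HOL-Algebra.Ring"
begin

text \<open>
  Boolean algebras have an explicit carrier, because the algebras of subsets of a space considered
  below are not full types. Only the signature of \<^typ>\<open>'a ring\<close> is reused: \<open>\<oplus>\<close> is the join and
  \<open>\<otimes>\<close> the meet, so these structures are not rings. The degenerate algebra with \<open>\<zero> = \<one>\<close> is allowed.
\<close>

record 'a boolalg = "'a ring" +
  bcompl :: "'a \<Rightarrow> 'a"

locale boolean_alg =
  fixes B :: "('a, 'm) boolalg_scheme" (structure)
  assumes join_closed: "\<lbrakk>a \<in> carrier B; b \<in> carrier B\<rbrakk> \<Longrightarrow> a \<oplus> b \<in> carrier B"
    and meet_closed: "\<lbrakk>a \<in> carrier B; b \<in> carrier B\<rbrakk> \<Longrightarrow> a \<otimes> b \<in> carrier B"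
    and compl_closed: "a \<in> carrier B \<Longrightarrow> bcompl B a \<in> carrier B"
    and bot_closed: "\<zero> \<in> carrier B"
    and top_closed: "\<one> \<in> carrier B"
    and join_assoc: "\<lbrakk>a \<in> carrier B; b \<in> carrier B; c \<in> carrier B\<rbrakk>
      \<Longrightarrow> (a \<oplus> b) \<oplus> c = a \<oplus> (b \<oplus> c)"
    and meet_assoc: "\<lbrakk>a \<in> carrier B; b \<in> carrier B; c \<in> carrier B\<rbrakk>
      \<Longrightarrow> (a \<otimes> b) \<otimes> c = a \<otimes> (b \<otimes> c)"
    and join_comm: "\<lbrakk>a \<in> carrier B; b \<in> carrier B\<rbrakk> \<Longrightarrow> a \<oplus> b = b \<oplus> a"
    and meet_comm: "\<lbrakk>a \<in> carrier B; b \<in> carrier B\<rbrakk> \<Longrightarrow> a \<otimes> b = b \<otimes> a"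
    and meet_join_distrib: "\<lbrakk>a \<in> carrier B; b \<in> carrier B; c \<in> carrier B\<rbrakk>
      \<Longrightarrow> a \<otimes> (b \<oplus> c) = (a \<otimes> b) \<oplus> (a \<otimes> c)"
    and join_meet_distrib: "\<lbrakk>a \<in> carrier B; b \<in> carrier B; c \<in> carrier B\<rbrakk>
      \<Longrightarrow> a \<oplus> (b \<otimes> c) = (a \<oplus> b) \<otimes> (a \<oplus> c)"
    and meet_top: "a \<in> carrier B \<Longrightarrow> a \<otimes> \<one> = a"
    and join_bot: "a \<in> carrier B \<Longrightarrow> a \<oplus> \<zero> = a"
    and meet_compl: "a \<in> carrier B \<Longrightarrow> a \<otimes> bcompl B a = \<zero>"
    and join_compl: "a \<in> carrier B \<Longrightarrow> a \<oplus> bcompl B a = \<one>"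

definition ba_le :: "('a, 'm) boolalg_scheme \<Rightarrow> 'a \<Rightarrow> 'a \<Rightarrow> bool" where
  "ba_le B a b \<longleftrightarrow> a \<otimes>\<^bsub>B\<^esub> b = a"

definition ba_complete :: "('a, 'm) boolalg_scheme \<Rightarrow> bool" where
  "ba_complete B \<longleftrightarrow> complete_lattice \<lparr>carrier = carrier B, eq = (=), le = ba_le B\<rparr>"

definition ba_iso_map ::
  "('a, 'm) boolalg_scheme \<Rightarrow> ('b, 'n) boolalg_scheme \<Rightarrow> ('a \<Rightarrow> 'b) \<Rightarrow> bool" where
  "ba_iso_map A B h \<longleftrightarrow>
     bij_betw h (carrier A) (carrier B) \<and>
     (\<forall>a\<in>carrier A. \<forall>b\<in>carrier A. h (a \<oplus>\<^bsub>A\<^esub> b) = h a \<oplus>\<^bsub>B\<^esub> h b) \<and>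
     (\<forall>a\<in>carrier A. \<forall>b\<in>carrier A. h (a \<otimes>\<^bsub>A\<^esub> b) = h a \<otimes>\<^bsub>B\<^esub> h b) \<and>
     (\<forall>a\<in>carrier A. h (bcompl A a) = bcompl B (h a)) \<and>
     h \<zero>\<^bsub>A\<^esub> = \<zero>\<^bsub>B\<^esub> \<and> h \<one>\<^bsub>A\<^esub> = \<one>\<^bsub>B\<^esub>"

definition ba_isomorphic :: "('a, 'm) boolalg_scheme \<Rightarrow> ('b, 'n) boolalg_scheme \<Rightarrow> bool" where
  "ba_isomorphic A B \<longleftrightarrow> (\<exists>h. ba_iso_map A B h)"

definition Grills :: "('a, 'm) boolalg_scheme \<Rightarrow> 'a set set" where
  "Grills B = {\<Gamma>. \<Gamma> \<subseteq> carrier B \<and> \<Gamma> \<noteq> {} \<and> \<zero>\<^bsub>B\<^esub> \<notin> \<Gamma> \<and>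
     (\<forall>a\<in>\<Gamma>. \<forall>b\<in>carrier B. ba_le B a b \<longrightarrow> b \<in> \<Gamma>) \<and>
     (\<forall>a\<in>carrier B. \<forall>b\<in>carrier B. a \<oplus>\<^bsub>B\<^esub> b \<in> \<Gamma> \<longrightarrow> a \<in> \<Gamma> \<or> b \<in> \<Gamma>)}"

definition proper_filters :: "('a, 'm) boolalg_scheme \<Rightarrow> 'a set set" where
  "proper_filters B = {F. F \<subseteq> carrier B \<and> F \<noteq> {} \<and> \<zero>\<^bsub>B\<^esub> \<notin> F \<and>
     (\<forall>a\<in>F. \<forall>b\<in>carrier B. ba_le B a b \<longrightarrow> b \<in> F) \<and>
     (\<forall>a\<in>F. \<forall>b\<in>F. a \<otimes>\<^bsub>B\<^esub> b \<in> F)}"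

definition Ult :: "('a, 'm) boolalg_scheme \<Rightarrow> 'a set set" where
  "Ult B = {U \<in> proper_filters B. \<forall>F\<in>proper_filters B. U \<subseteq> F \<longrightarrow> F = U}"

definition largest_contact :: "('a, 'm) boolalg_scheme \<Rightarrow> 'a \<Rightarrow> 'a \<Rightarrow> bool" where
  "largest_contact B a b \<longleftrightarrow> a \<noteq> \<zero>\<^bsub>B\<^esub> \<and> b \<noteq> \<zero>\<^bsub>B\<^esub>"

definition Clans :: "('a, 'm) boolalg_scheme \<Rightarrow> ('a \<Rightarrow> 'a \<Rightarrow> bool) \<Rightarrow> 'a set set" where
  "Clans B \<rho> = {\<Gamma> \<in> Grills B. \<forall>a\<in>\<Gamma>. \<forall>b\<in>\<Gamma>. \<rho> a b}"

definition RC :: "'x topology \<Rightarrow> 'x set boolalg" where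
  "RC X = \<lparr>carrier = {F. X closure_of (X interior_of F) = F},
           mult = (\<lambda>a b. X closure_of (X interior_of (a \<inter> b))),
           one = topspace X,
           zero = {},
           add = (\<union>),
           bcompl = (\<lambda>a. X closure_of (topspace X - a))\<rparr>"

definition CO :: "'x topology \<Rightarrow> 'x set boolalg" where
  "CO X = \<lparr>carrier = {F. openin X F \<and> closedin X F},
           mult = (\<inter>),
           one = topspace X,
           zero = {},
           add = (\<union>),
           bcompl = (\<lambda>a. topspace X - a)\<rparr>"

definition topological_pair :: "'x topology \<Rightarrow> 'x set \<Rightarrow> bool" where
  "topological_pair X X0 \<longleftrightarrow> X0 \<subseteq> topspace X \<and> X closure_of X0 = topspace X"

definition RC_pair :: "'x topology \<Rightarrow> 'x set \<Rightarrow> 'x set boolalg" where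
  "RC_pair X X0 = (RC X)\<lparr>carrier := (\<lambda>A. X closure_of A) ` carrier (CO (subtopology X X0))\<rparr>"

definition point_grill :: "'x topology \<Rightarrow> 'x set \<Rightarrow> 'x \<Rightarrow> 'x set set" where
  "point_grill X X0 x = {F \<in> carrier (CO (subtopology X X0)). x \<in> X closure_of F}"

text \<open>
  Intersecting with \<^term>\<open>topspace X\<close> makes the intersection of the empty family the whole space.
\<close>

definition closed_base :: "'x topology \<Rightarrow> 'x set set \<Rightarrow> bool" where
  "closed_base X \<C> \<longleftrightarrow> (\<forall>C\<in>\<C>. closedin X C) \<and>
     (\<forall>F. closedin X F \<longrightarrow> (\<exists>\<D>\<subseteq>\<C>. F = topspace X \<inter> \<Inter>\<D>))"

definition zero_dimensional :: "'x topology \<Rightarrow> bool" where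
  "zero_dimensional X \<longleftrightarrow> openin X = arbitrary union_of (\<lambda>U. openin X U \<and> closedin X U)"

definition stone_space :: "'x topology \<Rightarrow> bool" where
  "stone_space X \<longleftrightarrow> compact_space X \<and> Hausdorff_space X \<and> zero_dimensional X"

definition stone_2_space :: "'x topology \<Rightarrow> 'x set \<Rightarrow> bool" where
  "stone_2_space X X0 \<longleftrightarrow>
     topological_pair X X0 \<and>
     t0_space X \<and>
     stone_space (subtopology X X0) \<and>
     closed_base X (carrier (RC_pair X X0)) \<and>
     (\<forall>\<Gamma>\<in>Grills (CO (subtopology X X0)). \<exists>x\<in>topspace X. \<Gamma> = point_grill X X0 x)"

definition S2S_isomorphic ::
  "'x topology \<Rightarrow> 'x set \<Rightarrow> 'y topology \<Rightarrow> 'y set \<Rightarrow> bool" where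
  "S2S_isomorphic X X0 Y Y0 \<longleftrightarrow> (\<exists>f. homeomorphic_map X Y f \<and> f ` X0 = Y0)"

definition canonical_points :: "('a, 'm) boolalg_scheme \<Rightarrow> 'a set set" where
  "canonical_points B = Clans B (largest_contact B)"

definition canonical_g :: "('a, 'm) boolalg_scheme \<Rightarrow> 'a \<Rightarrow> 'a set set" where
  "canonical_g B a = {\<Gamma> \<in> canonical_points B. a \<in> \<Gamma>}"

text \<open>
  The topology on the clans whose closed base consists of the sets \<^term>\<open>canonical_g B a\<close>, given by
  the base of their complements. That these are closed under binary intersection, so that
  \<^const>\<open>topology\<close> yields the intended topology, is shown below.
\<close>

definition canonical_topology :: "('a, 'm) boolalg_scheme \<Rightarrow> 'a set topology" where
  "canonical_topology B = topology (arbitrary union_of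
     (\<lambda>U. \<exists>a\<in>carrier B. U = canonical_points B - canonical_g B a))"

context boolean_alg
begin

lemma meet_bot: "a \<in> carrier B \<Longrightarrow> a \<otimes> \<zero> = \<zero>"
proof -
  assume a: "a \<in> carrier B"
  have "a \<otimes> \<zero> = (a \<otimes> \<zero>) \<oplus> (a \<otimes> bcompl B a)"
    using a by (simp add: join_bot meet_closed bot_closed meet_compl)
  also have "\<dots> = a \<otimes> (bcompl B a \<oplus> \<zero>)"
    using a by (simp add: meet_join_distrib join_comm bot_closed compl_closed)
  also have "\<dots> = \<zero>"
    using a by (simp add: join_bot compl_closed meet_compl)
  finally show ?thesis .
qed

lemma le_join: "\<lbrakk>a \<in> carrier B; b \<in> carrier B\<rbrakk> \<Longrightarrow> ba_le B a (a \<oplus> b)"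
proof -
  assume ab: "a \<in> carrier B" "b \<in> carrier B"
  have "a \<otimes> (a \<oplus> b) = (a \<oplus> \<zero>) \<otimes> (a \<oplus> b)"
    using ab by (simp add: join_bot)
  also have "\<dots> = a \<oplus> (\<zero> \<otimes> b)"
    using ab by (simp add: join_meet_distrib bot_closed)
  also have "\<zero> \<otimes> b = \<zero>"
    using ab meet_bot[of b] meet_comm[of "\<zero>" b] by (simp add: bot_closed)
  finally show ?thesis
    using ab by (simp add: ba_le_def join_bot)
qed

lemma canonical_g_join:
  assumes "a \<in> carrier B" "b \<in> carrier B"
  shows "canonical_g B (a \<oplus> b) = canonical_g B a \<union> canonical_g B b"
proof -
  have "a \<oplus> b \<in> \<Gamma> \<longleftrightarrow> a \<in> \<Gamma> \<or> b \<in> \<Gamma>" if "\<Gamma> \<in> Grills B" for \<Gamma>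
  proof -
    have "ba_le B a (a \<oplus> b)" "ba_le B b (a \<oplus> b)"
      using assms le_join join_comm by metis+
    then show ?thesis
      using that assms join_closed unfolding Grills_def by blast
  qed
  then show ?thesis
    by (auto simp: canonical_g_def canonical_points_def Clans_def)
qed

lemma openin_canonical_topology:
  "openin (canonical_topology B) = arbitrary union_of
     (\<lambda>U. \<exists>a\<in>carrier B. U = canonical_points B - canonical_g B a)"
  unfolding canonical_topology_def
proof (rule topology_inverse', rule istopology_base)
  fix S T
  assume "\<exists>a\<in>carrier B. S = canonical_points B - canonical_g B a"
    and "\<exists>a\<in>carrier B. T = canonical_points B - canonical_g B a"
  then obtain a b where ab: "a \<in> carrier B" "b \<in> carrier B"
    and "S = canonical_points B - canonical_g B a" "T = canonical_points B - canonical_g B b"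
    by blast
  then have "S \<inter> T = canonical_points B - canonical_g B (a \<oplus> b)"
    by (auto simp: canonical_g_join)
  then show "\<exists>a\<in>carrier B. S \<inter> T = canonical_points B - canonical_g B a"
    using ab join_closed by blast
qed

lemma topspace_canonical_topology: "topspace (canonical_topology B) = canonical_points B"
proof -
  have "canonical_points B - canonical_g B \<zero> = canonical_points B"
    by (auto simp: canonical_g_def canonical_points_def Clans_def Grills_def)
  then have "openin (canonical_topology B) (canonical_points B)"
    unfolding openin_canonical_topology
    by (intro arbitrary_union_of_inc) (use bot_closed in blast)
  moreover have "U \<subseteq> canonical_points B" if "openin (canonical_topology B) U" for U
    using that unfolding openin_canonical_topology union_of_def by fastforce
  ultimately show ?thesis
    using openin_subset openin_topspace by (intro subset_antisym) simp_all
qed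

lemma closed_base_canonical_topology:
  "closed_base (canonical_topology B) (canonical_g B ` carrier B)"
  unfolding closed_base_def topspace_canonical_topology
proof (intro conjI ballI allI impI)
  fix C assume "C \<in> canonical_g B ` carrier B"
  then obtain a where a: "a \<in> carrier B" "C = canonical_g B a" by blast
  then have "openin (canonical_topology B) (canonical_points B - C)"
    unfolding openin_canonical_topology by (intro arbitrary_union_of_inc) blast
  then show "closedin (canonical_topology B) C"
    using a by (auto simp: closedin_def topspace_canonical_topology canonical_g_def)
next
  fix F assume F: "closedin (canonical_topology B) F"
  then have sub: "F \<subseteq> canonical_points B"
    and op: "openin (canonical_topology B) (canonical_points B - F)"
    by (auto simp: closedin_def topspace_canonical_topology)
  obtain \<U> where
    sub_base: "\<U> \<subseteq> Collect (\<lambda>U. \<exists>a\<in>carrier B. U = canonical_points B - canonical_g B a)"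
    and un: "\<Union>\<U> = canonical_points B - F"
    using op[unfolded openin_canonical_topology union_of_def] by (elim exE conjE) (rule that)
  have \<U>: "\<Union>\<U> = canonical_points B - F"
    "\<And>U. U \<in> \<U> \<Longrightarrow> \<exists>a\<in>carrier B. U = canonical_points B - canonical_g B a"
    using sub_base un by (simp, drule_tac subsetD) auto
  define \<D> where "\<D> = {C \<in> canonical_g B ` carrier B. canonical_points B - C \<in> \<U>}"
  have "F = canonical_points B \<inter> \<Inter>\<D>"
  proof
    show "F \<subseteq> canonical_points B \<inter> \<Inter>\<D>"
      using sub \<U>(1) by (auto simp: \<D>_def)
    show "canonical_points B \<inter> \<Inter>\<D> \<subseteq> F"
    proof
      fix x assume x: "x \<in> canonical_points B \<inter> \<Inter>\<D>"
      show "x \<in> F"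
      proof (rule ccontr)
        assume "x \<notin> F"
        then obtain U where U: "U \<in> \<U>" "x \<in> U" using x \<U>(1) by blast
        then obtain a where "a \<in> carrier B" "U = canonical_points B - canonical_g B a"
          using \<U>(2) by blast
        then have "canonical_g B a \<in> \<D>" "x \<notin> canonical_g B a"
          using U by (auto simp: \<D>_def)
        then show False using x by blast
      qed
    qed
  qed
  moreover have "\<D> \<subseteq> canonical_g B ` carrier B" by (auto simp: \<D>_def)
  ultimately show "\<exists>\<D>\<subseteq>canonical_g B ` carrier B. F = canonical_points B \<inter> \<Inter>\<D>"
    by blast
qed

end

end

theory Submission
  imports Defs
begin

text \<open>
  Any two nonzero elements are related by the largest contact relation, so the clans are exactly the
  grills, and every ultrafilter is a grill. By Stone's theorem \<open>a \<le> b\<close> iff every ultrafilter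
  containing \<open>a\<close> contains \<open>b\<close>; hence the order of \<open>B\<close> can be read off from the sets \<open>g a\<close>, and the
  closure of a set \<open>S\<close> of grills equals \<open>g c\<close> as soon as \<open>S \<subseteq> g d\<close> is equivalent to \<open>c \<le> d\<close>. This
  single criterion gives the closure of a Stone set, of the complement of \<open>g a\<close> (so that \<open>g\<close>
  preserves the operations) and, when \<open>B\<close> is complete, of an arbitrary open set.

  For the correspondence, a dense \<open>X\<^sub>0\<close> makes closure an isomorphism from the clopen algebra of \<open>X\<^sub>0\<close>
  onto \<open>RC(X, X\<^sub>0)\<close>, and \<open>x \<mapsto> {F. x \<in> F}\<close> identifies a Stone 2-space \<open>X\<close> with the grills of
  \<open>RC(X, X\<^sub>0)\<close>: it is injective by \<open>T\<^sub>0\<close>, surjective by (S2S4), and carries \<open>X\<^sub>0\<close> onto the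
  ultrafilters because \<open>X\<^sub>0\<close> is compact.
\<close>

(* Otherwise "X closure_of S" also parses as an application involving this constant. *)
no_notation eq_closure_of (\<open>closure'_of\<index>\<close>)

section \<open>Ultrafilters of a Boolean algebra\<close>

context boolean_alg
begin

section \<open>Order arithmetic in a Boolean algebra\<close>

lemmas ba_closed = join_closed meet_closed compl_closed bot_closed top_closed

lemma meet_idem: "a \<in> carrier B \<Longrightarrow> a \<otimes> a = a"
  using meet_join_distrib[of a a "bcompl B a"]
  by (simp add: ba_closed join_bot meet_compl join_compl meet_top)

lemma ba_le_trans:
  "\<lbrakk>ba_le B a b; ba_le B b c; a \<in> carrier B; b \<in> carrier B; c \<in> carrier B\<rbrakk> \<Longrightarrow> ba_le B a c"
  unfolding ba_le_def by (metis meet_assoc)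

lemma ba_le_antisym:
  "\<lbrakk>ba_le B a b; ba_le B b a; a \<in> carrier B; b \<in> carrier B\<rbrakk> \<Longrightarrow> a = b"
  unfolding ba_le_def by (metis meet_comm)

lemma meet_le1: "\<lbrakk>a \<in> carrier B; b \<in> carrier B\<rbrakk> \<Longrightarrow> ba_le B (a \<otimes> b) a"
  by (simp add: ba_le_def meet_comm[of a b] meet_assoc meet_idem)

lemma meet_le2: "\<lbrakk>a \<in> carrier B; b \<in> carrier B\<rbrakk> \<Longrightarrow> ba_le B (a \<otimes> b) b"
  by (simp add: ba_le_def meet_assoc meet_idem)

lemma le_meetI:
  "\<lbrakk>ba_le B c a; ba_le B c b; a \<in> carrier B; b \<in> carrier B; c \<in> carrier B\<rbrakk> \<Longrightarrow> ba_le B c (a \<otimes> b)"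
  unfolding ba_le_def by (metis meet_assoc)

lemma ba_le_top: "a \<in> carrier B \<Longrightarrow> ba_le B a \<one>"
  by (simp add: ba_le_def meet_top)

lemma ba_le_bot: "\<lbrakk>ba_le B a \<zero>; a \<in> carrier B\<rbrakk> \<Longrightarrow> a = \<zero>"
  by (simp add: ba_le_def meet_bot)

lemma ba_leI:
  assumes "a \<in> carrier B" "b \<in> carrier B" "a \<otimes> bcompl B b = \<zero>"
  shows "ba_le B a b"
  using assms meet_join_distrib[of a b "bcompl B b"]
  by (simp add: ba_le_def ba_closed join_bot join_compl meet_top)

lemma le_complI:
  assumes "a \<in> carrier B" "b \<in> carrier B" "a \<otimes> b = \<zero>"
  shows "ba_le B a (bcompl B b)"
  using assms meet_join_distrib[of a b "bcompl B b"] join_comm[of \<zero> "a \<otimes> bcompl B b"]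
  by (simp add: ba_le_def ba_closed join_bot join_compl meet_top)

text \<open>Describing the supremum \<open>c\<close> by the elements above it gives the same shape
  as the closure criterion for the sets \<open>canonical_g B c\<close>, so suprema can be compared
  with closures directly. Infima are recovered as suprema of lower bounds.\<close>

lemma ba_complete_iff:
  "ba_complete B \<longleftrightarrow> (\<forall>A\<subseteq>carrier B. \<exists>c\<in>carrier B. \<forall>d\<in>carrier B. ba_le B c d \<longleftrightarrow> (\<forall>a\<in>A. ba_le B a d))"
    (is "?L \<longleftrightarrow> ?R")
proof
  assume ?L
  then interpret complete_lattice "\<lparr>carrier = carrier B, eq = (=), le = ba_le B\<rparr>"
    unfolding ba_complete_def .
  show ?R
  proof (intro allI impI)
    fix A assume A: "A \<subseteq> carrier B"
    then obtain c where c: "c \<in> carrier B" "\<And>a. a \<in> A \<Longrightarrow> ba_le B a c"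
      "\<And>d. \<lbrakk>d \<in> carrier B; \<forall>a\<in>A. ba_le B a d\<rbrakk> \<Longrightarrow> ba_le B c d"
      using sup_exists[of A] by (fastforce simp: least_def Upper_def)
    with A show "\<exists>c\<in>carrier B. \<forall>d\<in>carrier B. ba_le B c d \<longleftrightarrow> (\<forall>a\<in>A. ba_le B a d)"
      by (meson ba_le_trans subsetD)
  qed
next
  assume R: ?R
  interpret partial_order "\<lparr>carrier = carrier B, eq = (=), le = ba_le B\<rparr>"
  proof (unfold_locales, simp_all)
    show "ba_le B x x" if "x \<in> carrier B" for x
      using that by (simp add: ba_le_def meet_idem)
    show "x = y" if "ba_le B x y" "ba_le B y x" "x \<in> carrier B" "y \<in> carrier B" for x y
      using that by (rule ba_le_antisym)
    show "ba_le B x z"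
      if "ba_le B x y" "ba_le B y z" "x \<in> carrier B" "y \<in> carrier B" "z \<in> carrier B" for x y z
      using that by (rule ba_le_trans)
  qed
  show ?L
    unfolding ba_complete_def
  proof (rule complete_latticeI)
    fix A assume "A \<subseteq> carrier \<lparr>carrier = carrier B, eq = (=), le = ba_le B\<rparr>"
    then have A: "A \<subseteq> carrier B" by simp
    obtain c where "c \<in> carrier B" "\<forall>d\<in>carrier B. ba_le B c d \<longleftrightarrow> (\<forall>a\<in>A. ba_le B a d)"
      using R A by blast
    then have "least \<lparr>carrier = carrier B, eq = (=), le = ba_le B\<rparr> c
        (Upper \<lparr>carrier = carrier B, eq = (=), le = ba_le B\<rparr> A)"
      using le_refl[of c] A by (auto simp: least_def Upper_def subset_iff)
    then show "\<exists>s. least \<lparr>carrier = carrier B, eq = (=), le = ba_le B\<rparr> s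
        (Upper \<lparr>carrier = carrier B, eq = (=), le = ba_le B\<rparr> A)" ..
    \<comment> \<open>The infimum of \<open>A\<close> is the supremum of its lower bounds: every
      member of \<open>A\<close> bounds \<open>L\<close> from above.\<close>
    define L where "L = {d \<in> carrier B. \<forall>a\<in>A. ba_le B d a}"
    obtain i where "i \<in> carrier B" "\<forall>d\<in>carrier B. ba_le B i d \<longleftrightarrow> (\<forall>a\<in>L. ba_le B a d)"
      using R[rule_format, of L] by (auto simp: L_def)
    then have "greatest \<lparr>carrier = carrier B, eq = (=), le = ba_le B\<rparr> i
        (Lower \<lparr>carrier = carrier B, eq = (=), le = ba_le B\<rparr> A)"
      using le_refl[of i] A by (auto simp: greatest_def Lower_def L_def subset_iff)
    then show "\<exists>i. greatest \<lparr>carrier = carrier B, eq = (=), le = ba_le B\<rparr> i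
        (Lower \<lparr>carrier = carrier B, eq = (=), le = ba_le B\<rparr> A)" ..
  qed
qed

section \<open>Filters, ultrafilters and primeness\<close>

lemma proper_filterD:
  assumes "F \<in> proper_filters B"
  shows "F \<subseteq> carrier B" "\<zero> \<notin> F" "\<one> \<in> F"
    and "\<lbrakk>a \<in> F; b \<in> carrier B; ba_le B a b\<rbrakk> \<Longrightarrow> b \<in> F"
    and "\<lbrakk>a \<in> F; b \<in> F\<rbrakk> \<Longrightarrow> a \<otimes> b \<in> F"
proof -
  show F: "F \<subseteq> carrier B" "\<zero> \<notin> F"
    and up: "\<And>a b. \<lbrakk>a \<in> F; b \<in> carrier B; ba_le B a b\<rbrakk> \<Longrightarrow> b \<in> F"
    and "\<And>a b. \<lbrakk>a \<in> F; b \<in> F\<rbrakk> \<Longrightarrow> a \<otimes> b \<in> F"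
    using assms unfolding proper_filters_def by blast+
  obtain a where "a \<in> F" using assms by (auto simp: proper_filters_def)
  then show "\<one> \<in> F" using up F(1) ba_le_top top_closed by blast
qed

text \<open>Zorn's lemma on the proper filters containing \<open>F\<close>. Two elements of the
  union of a chain already lie in a common member, so the union is closed under meets.\<close>

lemma filter_extends_to_ultrafilter:
  assumes F: "F \<in> proper_filters B"
  obtains U where "U \<in> Ult B" "F \<subseteq> U"
proof -
  let ?A = "{G \<in> proper_filters B. F \<subseteq> G}"
  have "\<exists>M\<in>?A. \<forall>G\<in>?A. M \<subseteq> G \<longrightarrow> G = M"
  proof (rule subset_Zorn_nonempty)
    show "?A \<noteq> {}" using F by blast
    fix \<C> assume ne: "\<C> \<noteq> {}" and ch: "subset.chain ?A \<C>"
    have cA: "\<C> \<subseteq> ?A" and tot: "\<And>G H. \<lbrakk>G \<in> \<C>; H \<in> \<C>\<rbrakk> \<Longrightarrow> G \<subseteq> H \<or> H \<subseteq> G"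
      using ch by (auto simp: subset_chain_def)
    have "a \<otimes> b \<in> \<Union>\<C>" if ab: "a \<in> \<Union>\<C>" "b \<in> \<Union>\<C>" for a b
    proof -
      obtain G H where "G \<in> \<C>" "H \<in> \<C>" "a \<in> G" "b \<in> H" using ab by blast
      then obtain K where K: "K \<in> \<C>" "a \<in> K" "b \<in> K" using tot by blast
      then have "a \<otimes> b \<in> K" using cA proper_filterD(5) by blast
      then show ?thesis using K(1) by blast
    qed
    moreover have "\<Union>\<C> \<noteq> {}" using ne cA by (fastforce simp: proper_filters_def)
    moreover have "\<Union>\<C> \<subseteq> carrier B" "\<zero> \<notin> \<Union>\<C>"
      using cA proper_filterD(1,2) by blast+
    moreover have "\<And>a b. \<lbrakk>a \<in> \<Union>\<C>; b \<in> carrier B; ba_le B a b\<rbrakk> \<Longrightarrow> b \<in> \<Union>\<C>"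
      using cA proper_filterD(4) by blast
    ultimately have "\<Union>\<C> \<in> proper_filters B" by (simp add: proper_filters_def)
    then show "\<Union>\<C> \<in> ?A" using ne cA by blast
  qed
  then obtain M where M: "M \<in> ?A" and max: "\<forall>G\<in>?A. M \<subseteq> G \<longrightarrow> G = M"
    by (elim bexE)
  \<comment> \<open>Maximality above \<open>F\<close> is maximality among all proper filters, since
    any filter containing \<open>M\<close> contains \<open>F\<close>.\<close>
  have "G = M" if "G \<in> proper_filters B" "M \<subseteq> G" for G
    using that M by (intro max[rule_format]) auto
  with M have "M \<in> Ult B" "F \<subseteq> M" by (simp_all add: Ult_def)
  then show thesis by (rule that)
qed

text \<open>If neither element belonged to \<open>U\<close>, adjoining \<open>a\<close> would still
  give a proper filter: \<open>u \<otimes> a = \<zero>\<close> would put the complement above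
  \<open>u\<close>, hence in \<open>U\<close>. Maximality then forces \<open>a\<close> into
  \<open>U\<close>.\<close>

lemma ultrafilter_compl:
  assumes U: "U \<in> Ult B" and a: "a \<in> carrier B"
  shows "bcompl B a \<in> U \<longleftrightarrow> a \<notin> U"
proof
  have F: "U \<in> proper_filters B" using U by (simp add: Ult_def)
  show "a \<notin> U" if "bcompl B a \<in> U"
    using that proper_filterD(2,5)[OF F] meet_compl[OF a] by metis
  show "bcompl B a \<in> U" if "a \<notin> U"
  proof (rule ccontr)
    assume nc: "bcompl B a \<notin> U"
    \<comment> \<open>The filter generated by \<open>U\<close> and \<open>a\<close>.\<close>
    let ?G = "{c \<in> carrier B. \<exists>u\<in>U. ba_le B (u \<otimes> a) c}"
    have Uc: "u \<in> carrier B" if "u \<in> U" for u using that proper_filterD(1)[OF F] by blast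
    have "?G \<in> proper_filters B"
      unfolding proper_filters_def
    proof (rule CollectI, intro conjI ballI impI)
      show "?G \<noteq> {}"
        using proper_filterD(3)[OF F] ba_le_top[of "\<one> \<otimes> a"] a ba_closed by blast
      show "\<zero> \<notin> ?G"
      proof
        assume "\<zero> \<in> ?G"
        then obtain u where u: "u \<in> U" "u \<otimes> a = \<zero>"
          using ba_le_bot a Uc meet_closed by blast
        then have "ba_le B u (bcompl B a)" using le_complI a Uc by blast
        then show False using nc u(1) proper_filterD(4)[OF F] compl_closed[OF a] by blast
      qed
    next
      fix c d assume "c \<in> ?G" "d \<in> carrier B" "ba_le B c d"
      then show "d \<in> ?G" using ba_le_trans a Uc meet_closed by blast
    next
      fix c d assume cd: "c \<in> ?G" "d \<in> ?G"
      then obtain u v where uv: "u \<in> U" "ba_le B (u \<otimes> a) c" "v \<in> U" "ba_le B (v \<otimes> a) d" by blast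
      have car: "c \<in> carrier B" "d \<in> carrier B" "u \<in> carrier B" "v \<in> carrier B"
        using cd uv Uc by auto
      have "ba_le B ((u \<otimes> v) \<otimes> a) (u \<otimes> a)" "ba_le B ((u \<otimes> v) \<otimes> a) (v \<otimes> a)"
        using car a by (meson ba_le_trans le_meetI meet_closed meet_le1 meet_le2)+
      then have "ba_le B ((u \<otimes> v) \<otimes> a) (c \<otimes> d)"
        using car a uv by (meson ba_le_trans le_meetI meet_closed)
      then show "c \<otimes> d \<in> ?G"
        using car uv proper_filterD(5)[OF F] meet_closed by blast
    qed auto
    moreover have "U \<subseteq> ?G" using Uc meet_le1 a by blast
    ultimately have "?G = U" using U by (auto simp: Ult_def)
    moreover have "a \<in> ?G" using a proper_filterD(3)[OF F] meet_le2 top_closed by blast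
    ultimately show False using that by simp
  qed
qed

text \<open>A proper filter cannot contain both an element and its complement, so \<open>F\<close>,
  which already decides every element, leaves nothing to add.\<close>

lemma UltI:
  assumes F: "F \<in> proper_filters B" and c: "\<And>a. a \<in> carrier B \<Longrightarrow> a \<in> F \<or> bcompl B a \<in> F"
  shows "F \<in> Ult B"
proof -
  have "a \<in> F" if G: "G \<in> proper_filters B" "F \<subseteq> G" and a: "a \<in> G" for G a
  proof (rule ccontr)
    assume "a \<notin> F"
    moreover have ac: "a \<in> carrier B" using proper_filterD(1)[OF G(1)] a by blast
    ultimately have "bcompl B a \<in> G" using c G(2) by blast
    then show False using proper_filterD(2,5)[OF G(1)] a meet_compl[OF ac] by metis
  qed
  then show ?thesis using F unfolding Ult_def by blast
qed

lemma ultrafilter_meet: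
  assumes U: "U \<in> Ult B" and ab: "a \<in> carrier B" "b \<in> carrier B"
  shows "a \<otimes> b \<in> U \<longleftrightarrow> a \<in> U \<and> b \<in> U"
proof -
  have F: "U \<in> proper_filters B" using U by (simp add: Ult_def)
  show ?thesis
    using proper_filterD(4,5)[OF F] meet_le1 meet_le2 ab by blast
qed

lemma ultrafilter_join:
  assumes U: "U \<in> Ult B" and ab: "a \<in> carrier B" "b \<in> carrier B"
  shows "a \<oplus> b \<in> U \<longleftrightarrow> a \<in> U \<or> b \<in> U"
proof
  have F: "U \<in> proper_filters B" using U by (simp add: Ult_def)
  show "a \<oplus> b \<in> U" if "a \<in> U \<or> b \<in> U"
    using that proper_filterD(4)[OF F] le_join ab join_comm join_closed by metis
  show "a \<in> U \<or> b \<in> U" if j: "a \<oplus> b \<in> U"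
  proof (rule disjCI)
    assume "b \<notin> U"
    \<comment> \<open>Meeting the join with the complement of \<open>b\<close> removes
      \<open>b\<close> and leaves an element below \<open>a\<close>.\<close>
    then have "bcompl B b \<otimes> (a \<oplus> b) \<in> U"
      using ultrafilter_compl[OF U] proper_filterD(5)[OF F] ab j by blast
    also have "bcompl B b \<otimes> (a \<oplus> b) = (bcompl B b \<otimes> a) \<oplus> \<zero>"
      using ab by (simp add: meet_join_distrib ba_closed meet_compl meet_comm[of "bcompl B b" b])
    finally show "a \<in> U"
      using ab by (simp add: join_bot ba_closed ultrafilter_meet[OF U])
  qed
qed

text \<open>The principal filter of a nonzero element is proper, so it extends to an
  ultrafilter.\<close>

lemma nonzero_in_ultrafilter:
  assumes "a \<in> carrier B" "a \<noteq> \<zero>"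
  obtains U where "U \<in> Ult B" "a \<in> U"
proof -
  have "{c \<in> carrier B. ba_le B a c} \<in> proper_filters B"
    unfolding proper_filters_def
  proof (rule CollectI, intro conjI ballI impI)
    show "{c \<in> carrier B. ba_le B a c} \<noteq> {}"
      using assms ba_le_top top_closed by blast
    show "\<zero> \<notin> {c \<in> carrier B. ba_le B a c}"
      using assms ba_le_bot by blast
    show "d \<in> {c \<in> carrier B. ba_le B a c}"
      if "c \<in> {c \<in> carrier B. ba_le B a c}" "d \<in> carrier B" "ba_le B c d" for c d
      using that assms ba_le_trans[of a c d] by simp
    show "c \<otimes> d \<in> {c \<in> carrier B. ba_le B a c}"
      if "c \<in> {c \<in> carrier B. ba_le B a c}" "d \<in> {c \<in> carrier B. ba_le B a c}" for c d
      using that assms le_meetI[of a c d] by (simp add: meet_closed)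
  qed blast
  then obtain U where "U \<in> Ult B" "{c \<in> carrier B. ba_le B a c} \<subseteq> U"
    by (rule filter_extends_to_ultrafilter)
  moreover have "ba_le B a a" using assms by (simp add: ba_le_def meet_idem)
  ultimately show thesis using assms that by blast
qed

section \<open>The Stone map\<close>

text \<open>The classical Stone representation. As it is an injective homomorphism into sets,
  Boolean identities in \<open>B\<close> can be checked in set algebra.\<close>

definition stone_set :: "'a \<Rightarrow> 'a set set" where
  "stone_set a = {U \<in> Ult B. a \<in> U}"

lemma stone_set_join:
  "\<lbrakk>a \<in> carrier B; b \<in> carrier B\<rbrakk> \<Longrightarrow> stone_set (a \<oplus> b) = stone_set a \<union> stone_set b"
  by (auto simp: stone_set_def ultrafilter_join)

lemma stone_set_meet:
  "\<lbrakk>a \<in> carrier B; b \<in> carrier B\<rbrakk> \<Longrightarrow> stone_set (a \<otimes> b) = stone_set a \<inter> stone_set b"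
  by (auto simp: stone_set_def ultrafilter_meet)

lemma stone_set_compl: "a \<in> carrier B \<Longrightarrow> stone_set (bcompl B a) = Ult B - stone_set a"
  by (auto simp: stone_set_def ultrafilter_compl)

lemma stone_set_bot: "stone_set \<zero> = {}"
  using proper_filterD(2) by (auto simp: stone_set_def Ult_def)

lemma stone_set_top: "stone_set \<one> = Ult B"
  using proper_filterD(3) by (auto simp: stone_set_def Ult_def)

lemma stone_set_subset_Ult: "stone_set a \<subseteq> Ult B"
  by (auto simp: stone_set_def)

lemmas stone_set_simps =
  stone_set_join stone_set_meet stone_set_compl stone_set_bot stone_set_top

text \<open>If \<open>a\<close> is not below \<open>b\<close>, then
  \<open>a \<otimes> bcompl B b\<close> is nonzero, and an ultrafilter through it contains
  \<open>a\<close> but not \<open>b\<close>.\<close>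

lemma stone_set_subset_iff:
  assumes "a \<in> carrier B" "b \<in> carrier B"
  shows "stone_set a \<subseteq> stone_set b \<longleftrightarrow> ba_le B a b"
proof
  assume le: "ba_le B a b"
  then have "stone_set a = stone_set a \<inter> stone_set b"
    using stone_set_meet[OF assms] by (simp add: ba_le_def)
  then show "stone_set a \<subseteq> stone_set b" by blast
next
  assume sub: "stone_set a \<subseteq> stone_set b"
  show "ba_le B a b"
  proof (rule ba_leI[OF assms], rule ccontr)
    assume "a \<otimes> bcompl B b \<noteq> \<zero>"
    moreover have "a \<otimes> bcompl B b \<in> carrier B" using assms ba_closed by blast
    ultimately obtain U where "U \<in> Ult B" "a \<otimes> bcompl B b \<in> U"
      using nonzero_in_ultrafilter by blast
    then have "U \<in> stone_set a" "U \<notin> stone_set b"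
      using assms by (simp_all add: stone_set_def ultrafilter_meet ultrafilter_compl compl_closed)
    then show False using sub by blast
  qed
qed

lemma inj_on_stone_set: "inj_on stone_set (carrier B)"
proof (rule inj_onI)
  fix a b assume "a \<in> carrier B" "b \<in> carrier B" "stone_set a = stone_set b"
  then show "a = b"
    using stone_set_subset_iff[of a b] stone_set_subset_iff[of b a] ba_le_antisym by simp
qed

text \<open>Injectivity of the Stone map reduces this to double complementation of a subset of
  \<open>Ult B\<close>.\<close>

lemma compl_compl: "a \<in> carrier B \<Longrightarrow> bcompl B (bcompl B a) = a"
  by (rule inj_onD[OF inj_on_stone_set])
    (simp_all add: stone_set_compl compl_closed double_diff stone_set_subset_Ult)

lemma ultrafilter_eqI: "\<lbrakk>U \<in> Ult B; V \<in> Ult B; U \<subseteq> V\<rbrakk> \<Longrightarrow> U = V"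
  by (auto simp: Ult_def)

text \<open>Primeness is the grill condition on joins; the remaining clauses are shared by filters
  and grills.\<close>

lemma Ult_subset_Grills: "Ult B \<subseteq> Grills B"
proof
  fix U assume U: "U \<in> Ult B"
  then have "U \<in> proper_filters B" by (simp add: Ult_def)
  then show "U \<in> Grills B"
    using ultrafilter_join[OF U] unfolding Grills_def proper_filters_def by blast
qed

end

section \<open>The canonical Stone 2-space\<close>

text \<open>The closure is closed, hence an intersection of members of the base, and each of these
  members contains \<open>S\<close>.\<close>

lemma closure_of_closed_base:
  assumes C: "closed_base X \<C>" and S: "S \<subseteq> topspace X"
  shows "X closure_of S = topspace X \<inter> \<Inter>{K \<in> \<C>. S \<subseteq> K}"
proof
  show "X closure_of S \<subseteq> topspace X \<inter> \<Inter>{K \<in> \<C>. S \<subseteq> K}"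
    using C by (simp add: closed_base_def closure_of_subset_topspace le_Inf_iff closure_of_minimal)
  obtain \<D> where D: "\<D> \<subseteq> \<C>" "X closure_of S = topspace X \<inter> \<Inter>\<D>"
    using C closedin_closure_of unfolding closed_base_def by meson
  have "S \<subseteq> K" if "K \<in> \<D>" for K
    using closure_of_subset[OF S] D(2) that by blast
  with D(1) have "\<D> \<subseteq> {K \<in> \<C>. S \<subseteq> K}" by blast
  then show "topspace X \<inter> \<Inter>{K \<in> \<C>. S \<subseteq> K} \<subseteq> X closure_of S"
    unfolding D(2) by (intro Int_mono Inf_superset_mono order_refl)
qed

text \<open>An open set lies in the interior of its closure, so passing from the closure to its
  interior and closing again loses nothing.\<close>

lemma regular_closed_closure_of_open:
  assumes "openin X W"
  shows "X closure_of (X interior_of (X closure_of W)) = X closure_of W"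
proof
  show "X closure_of W \<subseteq> X closure_of (X interior_of (X closure_of W))"
    using assms by (intro closure_of_mono interior_of_maximal closure_of_subset openin_subset)
  show "X closure_of (X interior_of (X closure_of W)) \<subseteq> X closure_of W"
    by (intro closure_of_minimal interior_of_subset closedin_closure_of)
qed

context boolean_alg
begin

section \<open>The map g and closures in the canonical topology\<close>

lemma canonical_points_eq_Grills: "canonical_points B = Grills B"
  unfolding canonical_points_def Clans_def largest_contact_def Grills_def by blast

lemma canonical_g_mono:
  assumes "ba_le B a b" "b \<in> carrier B"
  shows "canonical_g B a \<subseteq> canonical_g B b"
  using assms unfolding canonical_g_def canonical_points_eq_Grills Grills_def by blast

lemma canonical_g_Int_Ult: "canonical_g B a \<inter> Ult B = stone_set a"
  using Ult_subset_Grills unfolding canonical_g_def stone_set_def canonical_points_eq_Grills by blast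

lemma canonical_g_subset_iff:
  assumes "a \<in> carrier B" "b \<in> carrier B"
  shows "canonical_g B a \<subseteq> canonical_g B b \<longleftrightarrow> ba_le B a b"
proof
  assume "canonical_g B a \<subseteq> canonical_g B b"
  then have "stone_set a \<subseteq> stone_set b"
    unfolding canonical_g_Int_Ult[symmetric] by blast
  then show "ba_le B a b" using assms by (simp add: stone_set_subset_iff)
qed (use assms canonical_g_mono in blast)

lemma inj_on_canonical_g: "inj_on (canonical_g B) (carrier B)"
  using inj_on_stone_set unfolding inj_on_def canonical_g_Int_Ult[symmetric] by metis

lemma canonical_g_top: "canonical_g B \<one> = canonical_points B"
proof -
  have "\<one> \<in> \<Gamma>" if \<Gamma>: "\<Gamma> \<in> Grills B" for \<Gamma>
  proof -
    obtain a where "a \<in> \<Gamma>" "a \<in> carrier B" using \<Gamma> unfolding Grills_def by blast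
    moreover then have "ba_le B a \<one>" by (simp add: ba_le_top)
    ultimately show ?thesis using \<Gamma> top_closed unfolding Grills_def by blast
  qed
  then show ?thesis by (auto simp: canonical_g_def canonical_points_eq_Grills)
qed

lemma canonical_g_bot: "canonical_g B \<zero> = {}"
  by (auto simp: canonical_g_def canonical_points_eq_Grills Grills_def)

lemma closure_of_canonical_topology:
  assumes "S \<subseteq> canonical_points B"
  shows "canonical_topology B closure_of S =
    {\<Gamma> \<in> canonical_points B. \<forall>a\<in>carrier B. S \<subseteq> canonical_g B a \<longrightarrow> a \<in> \<Gamma>}"
proof -
  have "canonical_topology B closure_of S =
      canonical_points B \<inter> \<Inter>{K \<in> canonical_g B ` carrier B. S \<subseteq> K}"
    using closure_of_closed_base[OF closed_base_canonical_topology] assms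
    by (simp add: topspace_canonical_topology)
  also have "\<dots> = {\<Gamma> \<in> canonical_points B. \<forall>a\<in>carrier B. S \<subseteq> canonical_g B a \<longrightarrow> a \<in> \<Gamma>}"
    by (auto simp: canonical_g_def)
  finally show ?thesis .
qed

text \<open>The hypothesis \<open>iff\<close> makes \<open>canonical_g B c\<close> the least basic
  closed set containing \<open>S\<close>: the choice \<open>d = c\<close> gives containment,
  monotonicity of \<open>canonical_g\<close> gives minimality.\<close>

lemma closure_eq_canonical_g:
  assumes S: "S \<subseteq> canonical_points B" and c: "c \<in> carrier B"
    and iff: "\<And>d. d \<in> carrier B \<Longrightarrow> S \<subseteq> canonical_g B d \<longleftrightarrow> ba_le B c d"
  shows "canonical_topology B closure_of S = canonical_g B c"
proof -
  have "S \<subseteq> canonical_g B c" using iff[OF c] c by (simp add: ba_le_def meet_idem)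
  moreover have "canonical_g B c \<subseteq> canonical_g B d" if "S \<subseteq> canonical_g B d" "d \<in> carrier B" for d
    using that iff canonical_g_mono by blast
  ultimately show ?thesis
    unfolding closure_of_canonical_topology[OF S] using c by (auto simp: canonical_g_def)
qed

lemma stone_set_subset_canonical_points: "stone_set a \<subseteq> canonical_points B"
  using Ult_subset_Grills by (auto simp: stone_set_def canonical_points_eq_Grills)

lemma closure_of_stone_set:
  assumes a: "a \<in> carrier B"
  shows "canonical_topology B closure_of (stone_set a) = canonical_g B a"
proof (rule closure_eq_canonical_g[OF stone_set_subset_canonical_points a])
  fix d assume d: "d \<in> carrier B"
  have "stone_set a \<subseteq> canonical_g B d \<longleftrightarrow> stone_set a \<subseteq> stone_set d"
    using stone_set_subset_Ult unfolding canonical_g_Int_Ult[symmetric] by blast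
  then show "stone_set a \<subseteq> canonical_g B d \<longleftrightarrow> ba_le B a d"
    using a d by (simp add: stone_set_subset_iff)
qed

text \<open>The inclusion says that \<open>canonical_g B (bcompl B a)\<close> and
  \<open>canonical_g B d\<close> cover the space. Since \<open>canonical_g\<close> turns joins into
  unions, this is an order relation in \<open>B\<close>, which the Stone map converts into set
  algebra. The result verifies the closure criterion for these basic open sets.\<close>

lemma Diff_canonical_g_compl_subset_iff:
  assumes a: "a \<in> carrier B" and d: "d \<in> carrier B"
  shows "canonical_points B - canonical_g B (bcompl B a) \<subseteq> canonical_g B d \<longleftrightarrow> ba_le B a d"
proof -
  have car: "bcompl B a \<in> carrier B" "bcompl B a \<oplus> d \<in> carrier B"
    using a d by (simp_all add: ba_closed)
  have "canonical_points B - canonical_g B (bcompl B a) \<subseteq> canonical_g B d \<longleftrightarrow>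
      canonical_g B \<one> \<subseteq> canonical_g B (bcompl B a \<oplus> d)"
    unfolding canonical_g_top canonical_g_join[OF car(1) d] by blast
  also have "\<dots> \<longleftrightarrow> stone_set \<one> \<subseteq> stone_set (bcompl B a \<oplus> d)"
    using car top_closed by (simp add: canonical_g_subset_iff stone_set_subset_iff)
  also have "\<dots> \<longleftrightarrow> stone_set a \<subseteq> stone_set d"
    unfolding stone_set_join[OF car(1) d] stone_set_compl[OF a] stone_set_top
    using stone_set_subset_Ult[of a] stone_set_subset_Ult[of d] by blast
  finally show ?thesis using a d by (simp add: stone_set_subset_iff)
qed

lemma closure_of_Diff_canonical_g_compl:
  assumes a: "a \<in> carrier B"
  shows "canonical_topology B closure_of (canonical_points B - canonical_g B (bcompl B a)) =
    canonical_g B a"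
  by (rule closure_eq_canonical_g[OF Diff_subset a Diff_canonical_g_compl_subset_iff[OF a]])

lemma closure_of_Diff_canonical_g:
  assumes a: "a \<in> carrier B"
  shows "canonical_topology B closure_of (canonical_points B - canonical_g B a) =
    canonical_g B (bcompl B a)"
  using closure_of_Diff_canonical_g_compl[OF compl_closed[OF a]] a by (simp add: compl_compl)

lemma openin_Diff_canonical_g:
  "a \<in> carrier B \<Longrightarrow> openin (canonical_topology B) (canonical_points B - canonical_g B a)"
  unfolding openin_canonical_topology by (intro arbitrary_union_of_inc) blast

lemma closedin_canonical_g: "a \<in> carrier B \<Longrightarrow> closedin (canonical_topology B) (canonical_g B a)"
  using closed_base_canonical_topology by (simp add: closed_base_def)

section \<open>The ultrafilters as a Stone space\<close>

lemma topspace_Ult: "topspace (subtopology (canonical_topology B) (Ult B)) = Ult B"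
  using Ult_subset_Grills
  by (auto simp: topspace_canonical_topology canonical_points_eq_Grills)

text \<open>The tool for placing a constructed ultrafilter in a closed set \<open>C\<close>: it
  suffices to extend a filter that contains every \<open>a\<close> with
  \<open>C \<subseteq> stone_set a\<close>. It holds because Stone sets are the traces of the basic
  closed sets on \<open>Ult B\<close>.\<close>

lemma mem_closedin_Ult:
  assumes C: "closedin (subtopology (canonical_topology B) (Ult B)) C"
    and U: "U \<in> Ult B" and all: "\<And>a. \<lbrakk>a \<in> carrier B; C \<subseteq> stone_set a\<rbrakk> \<Longrightarrow> a \<in> U"
  shows "U \<in> C"
proof -
  have CU: "C \<subseteq> Ult B" using closedin_subset[OF C] by (simp add: topspace_Ult)
  have points: "Ult B \<subseteq> canonical_points B"
    using Ult_subset_Grills by (simp add: canonical_points_eq_Grills)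
  have "U \<in> canonical_topology B closure_of C"
    using all CU U points
    unfolding closure_of_canonical_topology[OF order_trans[OF CU points]] canonical_g_Int_Ult[symmetric]
    by blast
  then have "U \<in> subtopology (canonical_topology B) (Ult B) closure_of C"
    using CU U by (simp add: closure_of_subtopology Int_absorb1)
  then show ?thesis using C by (simp add: closure_of_closedin)
qed

text \<open>Closed as the trace of \<open>canonical_g B a\<close>; open because the complement is
  the Stone set of \<open>bcompl B a\<close>.\<close>

lemma clopen_stone_set:
  assumes a: "a \<in> carrier B"
  shows "closedin (subtopology (canonical_topology B) (Ult B)) (stone_set a)"
    and "openin (subtopology (canonical_topology B) (Ult B)) (stone_set a)"
proof -
  have cl: "closedin (subtopology (canonical_topology B) (Ult B)) (stone_set b)"
    if "b \<in> carrier B" for b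
    using closedin_canonical_g[OF that] closedin_subtopology canonical_g_Int_Ult by metis
  show "closedin (subtopology (canonical_topology B) (Ult B)) (stone_set a)"
    by (rule cl[OF a])
  show "openin (subtopology (canonical_topology B) (Ult B)) (stone_set a)"
    using cl[OF compl_closed[OF a]] stone_set_subset_Ult[of a]
    unfolding openin_closedin_eq topspace_Ult stone_set_compl[OF a] by (rule conjI[rotated])
qed

text \<open>Compactness argued with filters: \<open>F\<close> is generated by the elements whose
  Stone sets contain \<open>C\<close> and those whose Stone sets contain its complement. Once
  \<open>\<zero>\<close> lies in \<open>F\<close>, some \<open>a\<close> and \<open>b\<close> of the
  two kinds have disjoint Stone sets, and \<open>C\<close> must be
  \<open>stone_set a\<close>.\<close>

lemma clopen_Ult_is_stone_set:
  assumes cl: "closedin (subtopology (canonical_topology B) (Ult B)) C"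
    and op: "openin (subtopology (canonical_topology B) (Ult B)) C"
  shows "C \<in> stone_set ` carrier B"
proof -
  have CU: "C \<subseteq> Ult B" using closedin_subset[OF cl] by (simp add: topspace_Ult)
  have cl': "closedin (subtopology (canonical_topology B) (Ult B)) (Ult B - C)"
    using op by (metis openin_closedin_eq topspace_Ult)
  define F where "F = {c \<in> carrier B. \<exists>a\<in>carrier B. \<exists>b\<in>carrier B.
    C \<subseteq> stone_set a \<and> Ult B - C \<subseteq> stone_set b \<and> stone_set a \<inter> stone_set b \<subseteq> stone_set c}"
  have inF: "c \<in> F" if "c \<in> carrier B" "C \<subseteq> stone_set c \<or> Ult B - C \<subseteq> stone_set c" for c
    unfolding F_def using that top_closed stone_set_top CU by blast
  \<comment> \<open>Otherwise an ultrafilter extending \<open>F\<close> would belong both to \<open>C\<close> and to its complement.\<close>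
  have "\<zero> \<in> F"
  proof (rule ccontr)
    assume z: "\<zero> \<notin> F"
    have "F \<in> proper_filters B"
      unfolding proper_filters_def
    proof (rule CollectI, intro conjI ballI impI)
      show "F \<subseteq> carrier B" by (auto simp: F_def)
      show "F \<noteq> {}" using inF[OF top_closed] CU stone_set_top by blast
      show "\<zero> \<notin> F" by (rule z)
      show "d \<in> F" if "c \<in> F" "d \<in> carrier B" "ba_le B c d" for c d
      proof -
        have "stone_set c \<subseteq> stone_set d" using that by (simp add: stone_set_subset_iff F_def)
        then show ?thesis using that unfolding F_def by blast
      qed
      show "c \<otimes> d \<in> F" if cF: "c \<in> F" and dF: "d \<in> F" for c d
      proof -
        obtain a b where ab: "a \<in> carrier B" "b \<in> carrier B" "C \<subseteq> stone_set a"
          "Ult B - C \<subseteq> stone_set b" "stone_set a \<inter> stone_set b \<subseteq> stone_set c"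
          using cF unfolding F_def by blast
        obtain a' b' where ab': "a' \<in> carrier B" "b' \<in> carrier B" "C \<subseteq> stone_set a'"
          "Ult B - C \<subseteq> stone_set b'" "stone_set a' \<inter> stone_set b' \<subseteq> stone_set d"
          using dF unfolding F_def by blast
        have cd: "c \<in> carrier B" "d \<in> carrier B" using cF dF by (simp_all add: F_def)
        have "C \<subseteq> stone_set (a \<otimes> a')" "Ult B - C \<subseteq> stone_set (b \<otimes> b')"
          "stone_set (a \<otimes> a') \<inter> stone_set (b \<otimes> b') \<subseteq> stone_set (c \<otimes> d)"
          using ab ab' cd by (auto simp: stone_set_meet)
        then show ?thesis
          unfolding F_def using ab(1,2) ab'(1,2) cd meet_closed by blast
      qed
    qed
    then obtain U where U: "U \<in> Ult B" "F \<subseteq> U" by (rule filter_extends_to_ultrafilter)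
    have "U \<in> C" by (rule mem_closedin_Ult[OF cl U(1)]) (use inF U(2) in blast)
    moreover have "U \<in> Ult B - C" by (rule mem_closedin_Ult[OF cl' U(1)]) (use inF U(2) in blast)
    ultimately show False by blast
  qed
  then have "\<exists>a\<in>carrier B. \<exists>b\<in>carrier B.
      C \<subseteq> stone_set a \<and> Ult B - C \<subseteq> stone_set b \<and> stone_set a \<inter> stone_set b = {}"
    by (simp add: F_def stone_set_bot)
  then obtain a b where a: "a \<in> carrier B" and "C \<subseteq> stone_set a" "Ult B - C \<subseteq> stone_set b"
    "stone_set a \<inter> stone_set b = {}"
    by (elim bexE conjE)
  then have "C = stone_set a" using stone_set_subset_Ult by blast
  with a show ?thesis by blast
qed

lemma carrier_CO_Ult:
  "carrier (CO (subtopology (canonical_topology B) (Ult B))) = stone_set ` carrier B"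
  using clopen_Ult_is_stone_set clopen_stone_set by (auto simp: CO_def)

text \<open>The elements whose Stone sets contain a finite intersection of members form a filter.
  The finite intersection property keeps \<open>\<zero>\<close> out, and an ultrafilter extending it
  lies in every member by \<open>mem_closedin_Ult\<close>.\<close>

lemma compact_space_Ult: "compact_space (subtopology (canonical_topology B) (Ult B))"
  unfolding compact_space_fip
proof (intro allI impI, elim conjE)
  fix \<U> :: "'a set set set"
  assume cl: "\<forall>C\<in>\<U>. closedin (subtopology (canonical_topology B) (Ult B)) C"
    and fip: "\<forall>\<F>. finite \<F> \<and> \<F> \<subseteq> \<U> \<longrightarrow> \<Inter>\<F> \<noteq> {}"
  define F where "F = {c \<in> carrier B. \<exists>\<F>. finite \<F> \<and> \<F> \<subseteq> \<U> \<and> \<F> \<noteq> {} \<and> \<Inter>\<F> \<subseteq> stone_set c}"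
  show "\<Inter>\<U> \<noteq> {}"
  \<comment> \<open>The empty family has intersection \<open>UNIV\<close>, which is nonempty; the
    filter argument treats the other case.\<close>
  proof (cases "\<U> = {}")
    case False
    have inF: "c \<in> F" if "c \<in> carrier B" "C \<in> \<U>" "C \<subseteq> stone_set c" for c C
    proof -
      have "finite {C} \<and> {C} \<subseteq> \<U> \<and> {C} \<noteq> {} \<and> \<Inter>{C} \<subseteq> stone_set c" using that by simp
      then show ?thesis unfolding F_def using that(1) by blast
    qed
    have "F \<in> proper_filters B"
      unfolding proper_filters_def
    proof (rule CollectI, intro conjI ballI impI)
      show "F \<subseteq> carrier B" by (auto simp: F_def)
      obtain C where C: "C \<in> \<U>" using False by blast
      then have "C \<subseteq> stone_set \<one>"
        using cl closedin_subset by (fastforce simp: topspace_Ult stone_set_top)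
      then show "F \<noteq> {}" using inF[OF top_closed C] by blast
      show "\<zero> \<notin> F"
      proof
        assume "\<zero> \<in> F"
        then have "\<exists>\<F>. finite \<F> \<and> \<F> \<subseteq> \<U> \<and> \<Inter>\<F> = {}" by (auto simp: F_def stone_set_bot)
        then obtain \<F> where "finite \<F>" "\<F> \<subseteq> \<U>" "\<Inter>\<F> = {}" by (elim exE conjE)
        then show False using fip[rule_format, of \<F>] by simp
      qed
      show "d \<in> F" if "c \<in> F" "d \<in> carrier B" "ba_le B c d" for c d
      proof -
        have "stone_set c \<subseteq> stone_set d" using that by (simp add: stone_set_subset_iff F_def)
        then show ?thesis using that unfolding F_def by blast
      qed
      show "c \<otimes> d \<in> F" if cF: "c \<in> F" and dF: "d \<in> F" for c d
      proof -
        obtain \<F> where F: "finite \<F>" "\<F> \<subseteq> \<U>" "\<F> \<noteq> {}" "\<Inter>\<F> \<subseteq> stone_set c"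
          using cF unfolding F_def mem_Collect_eq by (elim exE conjE)
        obtain \<G> where G: "finite \<G>" "\<G> \<subseteq> \<U>" "\<G> \<noteq> {}" "\<Inter>\<G> \<subseteq> stone_set d"
          using dF unfolding F_def mem_Collect_eq by (elim exE conjE)
        have cd: "c \<in> carrier B" "d \<in> carrier B" using cF dF by (simp_all add: F_def)
        have "finite (\<F> \<union> \<G>) \<and> \<F> \<union> \<G> \<subseteq> \<U> \<and> \<F> \<union> \<G> \<noteq> {} \<and> \<Inter>(\<F> \<union> \<G>) \<subseteq> stone_set (c \<otimes> d)"
          using F G unfolding stone_set_meet[OF cd] Inter_Un_distrib by (simp add: le_infI1 le_infI2)
        with meet_closed[OF cd] show ?thesis
          unfolding F_def mem_Collect_eq by (rule conjI[OF _ exI])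
      qed
    qed
    then obtain U where U: "U \<in> Ult B" "F \<subseteq> U" by (rule filter_extends_to_ultrafilter)
    have "U \<in> C" if C: "C \<in> \<U>" for C
      by (rule mem_closedin_Ult[OF cl[rule_format, OF C] U(1)]) (use inF[OF _ C] U(2) in blast)
    then show ?thesis by blast
  qed simp
qed

lemma stone_space_Ult: "stone_space (subtopology (canonical_topology B) (Ult B))"
  unfolding stone_space_def
proof (intro conjI)
  let ?T = "subtopology (canonical_topology B) (Ult B)"
  show "compact_space ?T" by (rule compact_space_Ult)
  show "Hausdorff_space ?T"
    unfolding Hausdorff_space_def topspace_Ult
  proof (intro allI impI, elim conjE)
    fix U V assume UV: "U \<in> Ult B" "V \<in> Ult B" "U \<noteq> V"
    then obtain a where a: "a \<in> U" "a \<notin> V" using ultrafilter_eqI by blast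
    then have car: "a \<in> carrier B" using UV(1) proper_filterD(1) by (auto simp: Ult_def)
    have "U \<in> stone_set a" "V \<in> stone_set (bcompl B a)"
      "disjnt (stone_set a) (stone_set (bcompl B a))"
      using UV a car by (auto simp: stone_set_compl) (auto simp: stone_set_def disjnt_def)
    then show "\<exists>S T. openin ?T S \<and> openin ?T T \<and> U \<in> S \<and> V \<in> T \<and> disjnt S T"
      using clopen_stone_set(2) car compl_closed by blast
  qed
  show "zero_dimensional ?T"
    unfolding zero_dimensional_def
  proof (intro ext iffI)
    fix W assume W: "openin ?T W"
    let ?D = "{stone_set a | a. a \<in> carrier B \<and> stone_set a \<subseteq> W}"
    have WU: "W \<subseteq> Ult B" using openin_subset[OF W] by (simp add: topspace_Ult)
    have "\<exists>a\<in>carrier B. U \<in> stone_set a \<and> stone_set a \<subseteq> W" if U: "U \<in> W" for U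
    proof -
      have "closedin ?T (Ult B - W)" using W by (metis openin_closedin_eq topspace_Ult)
      \<comment> \<open>Since \<open>U\<close> avoids the closed set \<open>Ult B - W\<close>, some
        Stone set containing that set omits \<open>U\<close>. The Stone set of the complement is
        then a clopen neighbourhood of \<open>U\<close> inside \<open>W\<close>.\<close>
      then obtain a where a: "a \<in> carrier B" "Ult B - W \<subseteq> stone_set a" "a \<notin> U"
        using mem_closedin_Ult[of "Ult B - W" U] U WU by blast
      then have "U \<in> stone_set (bcompl B a)" "stone_set (bcompl B a) \<subseteq> W"
        using U WU by (auto simp: stone_set_compl) (auto simp: stone_set_def)
      then show ?thesis using compl_closed[OF a(1)] by blast
    qed
    then have "W = \<Union>?D" by blast
    moreover have "?D \<subseteq> Collect (\<lambda>S. openin ?T S \<and> closedin ?T S)"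
      using clopen_stone_set by blast
    ultimately show "(arbitrary union_of (\<lambda>S. openin ?T S \<and> closedin ?T S)) W"
      unfolding union_of_def arbitrary_def by blast
  next
    fix W assume "(arbitrary union_of (\<lambda>S. openin ?T S \<and> closedin ?T S)) W"
    then show "openin ?T W" unfolding union_of_def by blast
  qed
qed

section \<open>The canonical algebra of the canonical space\<close>

lemma carrier_RC_pair_canonical:
  "carrier (RC_pair (canonical_topology B) (Ult B)) = canonical_g B ` carrier B"
  using closure_of_stone_set by (auto simp: RC_pair_def carrier_CO_Ult image_iff)

text \<open>Grills need not be closed under meets, so the plain intersection can be larger than the
  left side. Its interior is computed through complements, where a union appears and
  \<open>closure_of_Diff_canonical_g\<close> applies; De Morgan in \<open>B\<close>, checked on
  Stone sets, then yields \<open>a \<otimes> b\<close>.\<close>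

lemma canonical_g_meet:
  assumes ab: "a \<in> carrier B" "b \<in> carrier B"
  shows "canonical_g B (a \<otimes> b) = canonical_topology B closure_of
    (canonical_topology B interior_of (canonical_g B a \<inter> canonical_g B b))"
proof -
  let ?T = "canonical_topology B" and ?P = "canonical_points B"
  let ?c = "bcompl B a \<oplus> bcompl B b"
  have car: "bcompl B a \<in> carrier B" "bcompl B b \<in> carrier B" "?c \<in> carrier B"
    using ab by (simp_all add: ba_closed)
  have "?T interior_of (canonical_g B a \<inter> canonical_g B b) =
      ?P - ?T closure_of ((?P - canonical_g B a) \<union> (?P - canonical_g B b))"
    unfolding interior_of_closure_of topspace_canonical_topology by (simp add: Diff_Int)
  also have "\<dots> = ?P - canonical_g B ?c"
    using ab car by (simp add: closure_of_Un closure_of_Diff_canonical_g canonical_g_join)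
  finally have "?T closure_of (?T interior_of (canonical_g B a \<inter> canonical_g B b)) =
      canonical_g B (bcompl B ?c)"
    using car by (simp add: closure_of_Diff_canonical_g)
  also have "bcompl B ?c = a \<otimes> b"
    by (rule inj_onD[OF inj_on_stone_set])
      (use ab car stone_set_subset_Ult in \<open>auto simp: stone_set_simps ba_closed\<close>)
  finally show ?thesis by simp
qed

lemma ba_iso_map_canonical_g:
  "ba_iso_map B (RC_pair (canonical_topology B) (Ult B)) (canonical_g B)"
  unfolding ba_iso_map_def bij_betw_def carrier_RC_pair_canonical
  using inj_on_canonical_g
  by (simp add: RC_pair_def RC_def canonical_g_join canonical_g_meet canonical_g_top
      canonical_g_bot topspace_canonical_topology closure_of_Diff_canonical_g)

lemma stone_2_space_canonical: "stone_2_space (canonical_topology B) (Ult B)"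
  unfolding stone_2_space_def
proof (intro conjI ballI)
  \<comment> \<open>Density: \<open>Ult B\<close> is the Stone set of \<open>\<one>\<close>, so its
    closure is \<open>canonical_g B \<one>\<close>, the whole space.\<close>
  show "topological_pair (canonical_topology B) (Ult B)"
    using closure_of_stone_set[OF top_closed] Ult_subset_Grills
    by (simp add: topological_pair_def topspace_canonical_topology canonical_points_eq_Grills
        stone_set_top canonical_g_top)
  show "t0_space (canonical_topology B)"
    unfolding t0_space_def topspace_canonical_topology
  proof (intro ballI impI)
    fix \<Gamma> \<Delta> assume GD: "\<Gamma> \<in> canonical_points B" "\<Delta> \<in> canonical_points B" "\<Gamma> \<noteq> \<Delta>"
    \<comment> \<open>An element on which the two grills differ yields the separating open set, the
      complement of \<open>canonical_g B a\<close>.\<close>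
    then obtain a where a: "a \<in> \<Gamma> \<longleftrightarrow> a \<notin> \<Delta>" by blast
    have "\<Gamma> \<subseteq> carrier B" "\<Delta> \<subseteq> carrier B"
      using GD unfolding canonical_points_eq_Grills Grills_def by blast+
    with a have "a \<in> carrier B" by blast
    moreover have "\<Gamma> \<notin> canonical_points B - canonical_g B a \<longleftrightarrow>
        \<Delta> \<in> canonical_points B - canonical_g B a"
      using a GD by (simp add: canonical_g_def)
    ultimately show "\<exists>U. openin (canonical_topology B) U \<and> (\<Gamma> \<notin> U \<longleftrightarrow> \<Delta> \<in> U)"
      using openin_Diff_canonical_g by blast
  qed
  show "stone_space (subtopology (canonical_topology B) (Ult B))"
    by (rule stone_space_Ult)
  show "closed_base (canonical_topology B) (carrier (RC_pair (canonical_topology B) (Ult B)))"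
    unfolding carrier_RC_pair_canonical by (rule closed_base_canonical_topology)
  fix G assume G: "G \<in> Grills (CO (subtopology (canonical_topology B) (Ult B)))"
  let ?C = "CO (subtopology (canonical_topology B) (Ult B))"
  have Gsub: "G \<subseteq> stone_set ` carrier B" and Gne: "G \<noteq> {}" and Gz: "{} \<notin> G"
    and Gup: "\<And>S b. \<lbrakk>S \<in> G; b \<in> carrier B; S \<subseteq> stone_set b\<rbrakk> \<Longrightarrow> stone_set b \<in> G"
    and Gjoin: "\<And>a b. \<lbrakk>a \<in> carrier B; b \<in> carrier B; stone_set a \<union> stone_set b \<in> G\<rbrakk>
      \<Longrightarrow> stone_set a \<in> G \<or> stone_set b \<in> G"
    using G[unfolded Grills_def carrier_CO_Ult ba_le_def] by (simp_all add: CO_def Int_absorb2)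
  \<comment> \<open>Clopen sets of \<open>Ult B\<close> are Stone sets, so pulling \<open>G\<close>
    back along the Stone map loses nothing and gives a grill of \<open>B\<close>. This grill is the
    point required by (S2S4).\<close>
  define \<Gamma> where "\<Gamma> = {a \<in> carrier B. stone_set a \<in> G}"
  have "\<Gamma> \<in> Grills B"
    unfolding Grills_def
  proof (rule CollectI, intro conjI ballI impI)
    show "\<Gamma> \<subseteq> carrier B" "\<Gamma> \<noteq> {}" "\<zero> \<notin> \<Gamma>"
      using Gsub Gne Gz by (auto simp: \<Gamma>_def stone_set_bot)
    show "b \<in> \<Gamma>" if "a \<in> \<Gamma>" "b \<in> carrier B" "ba_le B a b" for a b
      using that Gup[of "stone_set a" b] by (simp add: \<Gamma>_def stone_set_subset_iff)
    show "a \<in> \<Gamma> \<or> b \<in> \<Gamma>" if "a \<in> carrier B" "b \<in> carrier B" "a \<oplus> b \<in> \<Gamma>" for a b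
      using that Gjoin[of a b] by (simp add: \<Gamma>_def stone_set_join)
  qed
  then have pt: "\<Gamma> \<in> canonical_points B" by (simp add: canonical_points_eq_Grills)
  have "G = point_grill (canonical_topology B) (Ult B) \<Gamma>"
    using Gsub pt
    by (auto simp: point_grill_def carrier_CO_Ult closure_of_stone_set canonical_g_def \<Gamma>_def)
  with pt show "\<exists>x\<in>topspace (canonical_topology B). G = point_grill (canonical_topology B) (Ult B) x"
    by (auto simp: topspace_canonical_topology)
qed

section \<open>Regular closed sets and completeness\<close>

lemma canonical_g_regular_closed:
  assumes "a \<in> carrier B"
  shows "canonical_g B a \<in> carrier (RC (canonical_topology B))"
  using regular_closed_closure_of_open[OF openin_Diff_canonical_g[OF compl_closed[OF assms]]]
  by (simp add: RC_def closure_of_Diff_canonical_g_compl[OF assms])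

text \<open>For a family \<open>A\<close>, let \<open>W\<close> be the union of the interiors of the
  sets \<open>canonical_g B a\<close>. Then \<open>W \<subseteq> canonical_g B d\<close> iff
  \<open>d\<close> is an upper bound of \<open>A\<close>, so the closure of \<open>W\<close> is
  \<open>canonical_g B c\<close> exactly when \<open>c\<close> is the supremum of \<open>A\<close>.
  One direction starts from \<open>A\<close>; the other writes the interior of a regular closed set
  as such a \<open>W\<close>.\<close>

lemma RC_pair_canonical_eq_RC_iff_complete:
  "carrier (RC_pair (canonical_topology B) (Ult B)) = carrier (RC (canonical_topology B))
    \<longleftrightarrow> ba_complete B"
proof
  let ?T = "canonical_topology B" and ?P = "canonical_points B"
  assume eq: "carrier (RC_pair ?T (Ult B)) = carrier (RC ?T)"
  show "ba_complete B"
    unfolding ba_complete_iff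
  proof (intro allI impI)
    fix A assume A: "A \<subseteq> carrier B"
    \<comment> \<open>By \<open>closure_of_Diff_canonical_g\<close> each set in this union is the
      interior of \<open>canonical_g B a\<close>.\<close>
    define W where "W = (\<Union>a\<in>A. ?P - canonical_g B (bcompl B a))"
    have "openin ?T W"
      unfolding W_def using A openin_Diff_canonical_g compl_closed by (intro openin_Union) blast
    then have "?T closure_of W \<in> carrier (RC ?T)"
      by (simp add: RC_def regular_closed_closure_of_open)
    then obtain c where c: "c \<in> carrier B" "?T closure_of W = canonical_g B c"
      unfolding eq[symmetric] carrier_RC_pair_canonical by blast
    have WP: "W \<subseteq> topspace ?T" by (auto simp: W_def topspace_canonical_topology)
    have "ba_le B c d \<longleftrightarrow> (\<forall>a\<in>A. ba_le B a d)" if d: "d \<in> carrier B" for d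
    proof -
      have "ba_le B c d \<longleftrightarrow> ?T closure_of W \<subseteq> canonical_g B d"
        unfolding c(2) canonical_g_subset_iff[OF c(1) d] ..
      also have "\<dots> \<longleftrightarrow> W \<subseteq> canonical_g B d"
        using closure_of_subset[OF WP] closure_of_minimal closedin_canonical_g[OF d] by blast
      also have "\<dots> \<longleftrightarrow> (\<forall>a\<in>A. ?P - canonical_g B (bcompl B a) \<subseteq> canonical_g B d)"
        unfolding W_def by (rule UN_subset_iff)
      also have "\<dots> \<longleftrightarrow> (\<forall>a\<in>A. ba_le B a d)"
        using A by (intro ball_cong refl Diff_canonical_g_compl_subset_iff[OF _ d]) blast
      finally show ?thesis .
    qed
    with c(1) show "\<exists>c\<in>carrier B. \<forall>d\<in>carrier B. ba_le B c d \<longleftrightarrow> (\<forall>a\<in>A. ba_le B a d)"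
      by blast
  qed
next
  let ?T = "canonical_topology B" and ?P = "canonical_points B"
  assume complete: "ba_complete B"
  have "F \<in> canonical_g B ` carrier B" if "F \<in> carrier (RC ?T)" for F
  proof -
    have F: "?T closure_of (?T interior_of F) = F" using that by (simp add: RC_def)
    \<comment> \<open>The basic open sets inside the interior of \<open>F\<close>, indexed through
      complements; by \<open>compl_compl\<close> every basic open set has this form, so their union
      is the whole interior.\<close>
    define A where "A = {a \<in> carrier B. ?P - canonical_g B (bcompl B a) \<subseteq> ?T interior_of F}"
    obtain \<U> where U: "\<U> \<subseteq> Collect (\<lambda>U. \<exists>a\<in>carrier B. U = ?P - canonical_g B a)"
      and un: "\<Union>\<U> = ?T interior_of F"
      using openin_interior_of[of ?T F, unfolded openin_canonical_topology union_of_def]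
      by (elim exE conjE) (rule that)
    have "\<exists>a\<in>A. V = ?P - canonical_g B (bcompl B a)" if V: "V \<in> \<U>" for V
    proof -
      obtain a where a: "a \<in> carrier B" "V = ?P - canonical_g B a" using U V by blast
      then have "V = ?P - canonical_g B (bcompl B (bcompl B a))" by (simp add: compl_compl)
      moreover have "V \<subseteq> ?T interior_of F" using V un by blast
      ultimately show ?thesis using compl_closed[OF a(1)] unfolding A_def by blast
    qed
    then have "\<Union>\<U> \<subseteq> (\<Union>a\<in>A. ?P - canonical_g B (bcompl B a))" by fast
    moreover have "(\<Union>a\<in>A. ?P - canonical_g B (bcompl B a)) \<subseteq> ?T interior_of F"
      by (rule UN_least) (simp add: A_def)
    ultimately have int: "?T interior_of F = (\<Union>a\<in>A. ?P - canonical_g B (bcompl B a))"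
      using un by simp
    obtain c where c: "c \<in> carrier B" "\<And>d. d \<in> carrier B \<Longrightarrow> ba_le B c d \<longleftrightarrow> (\<forall>a\<in>A. ba_le B a d)"
      using complete[unfolded ba_complete_iff, rule_format, of A] unfolding A_def by blast
    have "?T closure_of (?T interior_of F) = canonical_g B c"
    proof (rule closure_eq_canonical_g[OF _ c(1)])
      show "?T interior_of F \<subseteq> ?P"
        using interior_of_subset_topspace[of ?T F] by (simp add: topspace_canonical_topology)
      fix d assume d: "d \<in> carrier B"
      show "?T interior_of F \<subseteq> canonical_g B d \<longleftrightarrow> ba_le B c d"
        unfolding int UN_subset_iff c(2)[OF d]
        by (intro ball_cong refl Diff_canonical_g_compl_subset_iff[OF _ d]) (simp add: A_def)
    qed
    with F c(1) show ?thesis by auto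
  qed
  then show "carrier (RC_pair ?T (Ult B)) = carrier (RC ?T)"
    unfolding carrier_RC_pair_canonical using canonical_g_regular_closed by blast
qed

end

section \<open>Functoriality and the correspondence\<close>

lemma ba_iso_mapD:
  assumes "ba_iso_map A B h"
  shows "bij_betw h (carrier A) (carrier B)" "inj_on h (carrier A)" "h ` carrier A = carrier B"
    and "\<lbrakk>a \<in> carrier A; b \<in> carrier A\<rbrakk> \<Longrightarrow> h (a \<oplus>\<^bsub>A\<^esub> b) = h a \<oplus>\<^bsub>B\<^esub> h b"
    and "\<lbrakk>a \<in> carrier A; b \<in> carrier A\<rbrakk> \<Longrightarrow> h (a \<otimes>\<^bsub>A\<^esub> b) = h a \<otimes>\<^bsub>B\<^esub> h b"
    and "a \<in> carrier A \<Longrightarrow> h (bcompl A a) = bcompl B (h a)"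
    and "h \<zero>\<^bsub>A\<^esub> = \<zero>\<^bsub>B\<^esub>" "h \<one>\<^bsub>A\<^esub> = \<one>\<^bsub>B\<^esub>"
  using assms by (simp_all add: ba_iso_map_def bij_betw_def)

text \<open>Here \<open>B\<close> is a bare structure and inherits the axioms along
  \<open>h\<close>. This makes \<open>RC_pair X X0\<close> a Boolean algebra by transport from the
  clopen algebra, without verifying the axioms on regular closed sets.\<close>

lemma ba_iso_map_boolean_alg:
  assumes A: "boolean_alg A" and h: "ba_iso_map A B h"
  shows "boolean_alg B"
proof -
  interpret boolean_alg A by (rule A)
  \<comment> \<open>Reversed, the homomorphism laws rewrite operations of \<open>B\<close> on images
    as images of operations of \<open>A\<close>.\<close>
  note hom = ba_iso_mapD(4-8)[OF h, symmetric]
  have B: "\<exists>a'\<in>carrier A. a = h a'" if "a \<in> carrier B" for a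
    using that ba_iso_mapD(3)[OF h] by blast
  have car: "a \<in> carrier A \<Longrightarrow> h a \<in> carrier B" for a
    using ba_iso_mapD(3)[OF h] by blast
  show ?thesis
  proof
    fix a b c
    assume "a \<in> carrier B" "b \<in> carrier B" "c \<in> carrier B"
    then obtain a' b' c' where "a' \<in> carrier A" "b' \<in> carrier A" "c' \<in> carrier A"
      "a = h a'" "b = h b'" "c = h c'" using B by meson
    note abc = this
    show "(a \<oplus>\<^bsub>B\<^esub> b) \<oplus>\<^bsub>B\<^esub> c = a \<oplus>\<^bsub>B\<^esub> (b \<oplus>\<^bsub>B\<^esub> c)"
      "(a \<otimes>\<^bsub>B\<^esub> b) \<otimes>\<^bsub>B\<^esub> c = a \<otimes>\<^bsub>B\<^esub> (b \<otimes>\<^bsub>B\<^esub> c)"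
      using abc by (simp_all add: hom ba_closed join_assoc meet_assoc)
    show "a \<otimes>\<^bsub>B\<^esub> (b \<oplus>\<^bsub>B\<^esub> c) = (a \<otimes>\<^bsub>B\<^esub> b) \<oplus>\<^bsub>B\<^esub> (a \<otimes>\<^bsub>B\<^esub> c)"
      using abc by (simp add: hom ba_closed meet_join_distrib)
    show "a \<oplus>\<^bsub>B\<^esub> (b \<otimes>\<^bsub>B\<^esub> c) = (a \<oplus>\<^bsub>B\<^esub> b) \<otimes>\<^bsub>B\<^esub> (a \<oplus>\<^bsub>B\<^esub> c)"
      using abc by (simp add: hom ba_closed join_meet_distrib)
  next
    fix a b
    assume "a \<in> carrier B" "b \<in> carrier B"
    then obtain a' b' where ab: "a' \<in> carrier A" "b' \<in> carrier A" "a = h a'" "b = h b'"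
      using B by meson
    then show "a \<oplus>\<^bsub>B\<^esub> b \<in> carrier B" "a \<otimes>\<^bsub>B\<^esub> b \<in> carrier B"
      by (simp_all add: hom ba_closed car)
    show "a \<oplus>\<^bsub>B\<^esub> b = b \<oplus>\<^bsub>B\<^esub> a" "a \<otimes>\<^bsub>B\<^esub> b = b \<otimes>\<^bsub>B\<^esub> a"
      using ab by (simp_all add: hom join_comm[of a'] meet_comm[of a'])
  next
    fix a
    assume "a \<in> carrier B"
    then obtain a' where "a' \<in> carrier A" "a = h a'" using B by meson
    then show "bcompl B a \<in> carrier B" "a \<otimes>\<^bsub>B\<^esub> \<one>\<^bsub>B\<^esub> = a" "a \<oplus>\<^bsub>B\<^esub> \<zero>\<^bsub>B\<^esub> = a"
      "a \<otimes>\<^bsub>B\<^esub> bcompl B a = \<zero>\<^bsub>B\<^esub>" "a \<oplus>\<^bsub>B\<^esub> bcompl B a = \<one>\<^bsub>B\<^esub>"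
      by (simp_all add: hom ba_closed car meet_top join_bot meet_compl join_compl)
  next
    show "\<zero>\<^bsub>B\<^esub> \<in> carrier B" "\<one>\<^bsub>B\<^esub> \<in> carrier B"
      by (simp_all add: hom ba_closed car)
  qed
qed

lemma ba_iso_map_inv_into:
  assumes A: "boolean_alg A" and h: "ba_iso_map A B h"
  shows "ba_iso_map B A (inv_into (carrier A) h)"
proof -
  interpret boolean_alg A by (rule A)
  note hom = ba_iso_mapD(4-8)[OF h, symmetric]
  note bij = ba_iso_mapD(1)[OF h]
  have inv: "inv_into (carrier A) h (h a) = a" if "a \<in> carrier A" for a
    using ba_iso_mapD(2)[OF h] that by simp
  show ?thesis
    unfolding ba_iso_map_def ba_iso_mapD(3)[OF h, symmetric]
  proof (intro conjI ballI)
    show "bij_betw (inv_into (carrier A) h) (h ` carrier A) (carrier A)"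
      using bij_betw_inv_into[OF bij] by (simp add: ba_iso_mapD(3)[OF h])
  qed (auto simp: hom inv ba_closed)
qed

lemma ba_isomorphic_sym: "\<lbrakk>boolean_alg A; ba_isomorphic A B\<rbrakk> \<Longrightarrow> ba_isomorphic B A"
  using ba_iso_map_inv_into unfolding ba_isomorphic_def by blast

lemma ba_isomorphic_trans:
  assumes "ba_isomorphic A B" "ba_isomorphic B C"
  shows "ba_isomorphic A C"
proof -
  obtain g h where gh: "ba_iso_map A B g" "ba_iso_map B C h"
    using assms unfolding ba_isomorphic_def by blast
  have "g a \<in> carrier B" if "a \<in> carrier A" for a
    using that ba_iso_mapD(3)[OF gh(1)] by blast
  then have "ba_iso_map A C (h \<circ> g)"
    using bij_betw_trans gh by (auto simp: ba_iso_map_def)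
  then show ?thesis unfolding ba_isomorphic_def by blast
qed

lemma ba_iso_map_le:
  assumes A: "boolean_alg A" and h: "ba_iso_map A B h" and ab: "a \<in> carrier A" "b \<in> carrier A"
  shows "ba_le B (h a) (h b) \<longleftrightarrow> ba_le A a b"
proof -
  have "a \<otimes>\<^bsub>A\<^esub> b \<in> carrier A" using boolean_alg.meet_closed[OF A ab] .
  then show ?thesis
    using ab inj_on_eq_iff[OF ba_iso_mapD(2)[OF h]]
    by (simp add: ba_le_def ba_iso_mapD(5)[OF h ab, symmetric])
qed

lemma ba_iso_map_image_mem_iff:
  "\<lbrakk>ba_iso_map A B h; a \<in> carrier A; S \<subseteq> carrier A\<rbrakk> \<Longrightarrow> h a \<in> h ` S \<longleftrightarrow> a \<in> S"
  by (rule inj_on_image_mem_iff[OF ba_iso_mapD(2)])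

lemma Grills_image:
  assumes A: "boolean_alg A" and h: "ba_iso_map A B h" and G: "\<Gamma> \<in> Grills A"
  shows "h ` \<Gamma> \<in> Grills B"
proof -
  interpret boolean_alg A by (rule A)
  have sub: "\<Gamma> \<subseteq> carrier A" and ne: "\<Gamma> \<noteq> {}" and z: "\<zero>\<^bsub>A\<^esub> \<notin> \<Gamma>"
    and up: "\<And>a b. \<lbrakk>a \<in> \<Gamma>; b \<in> carrier A; ba_le A a b\<rbrakk> \<Longrightarrow> b \<in> \<Gamma>"
    and join: "\<And>a b. \<lbrakk>a \<in> carrier A; b \<in> carrier A; a \<oplus>\<^bsub>A\<^esub> b \<in> \<Gamma>\<rbrakk> \<Longrightarrow> a \<in> \<Gamma> \<or> b \<in> \<Gamma>"
    using G unfolding Grills_def by blast+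
  note mem = ba_iso_map_image_mem_iff[OF h _ sub]
  show ?thesis
    unfolding Grills_def ba_iso_mapD(3)[OF h, symmetric]
  proof (rule CollectI, intro conjI)
    show "h ` \<Gamma> \<subseteq> h ` carrier A" "h ` \<Gamma> \<noteq> {}" using sub ne by blast+
    show "\<zero>\<^bsub>B\<^esub> \<notin> h ` \<Gamma>"
      using z mem[OF bot_closed] by (simp add: ba_iso_mapD(7)[OF h])
    show "\<forall>a\<in>h ` \<Gamma>. \<forall>b\<in>h ` carrier A. ba_le B a b \<longrightarrow> b \<in> h ` \<Gamma>"
      unfolding ball_simps(9)
    proof (intro ballI impI)
      fix a b assume a: "a \<in> \<Gamma>" and b: "b \<in> carrier A" and le: "ba_le B (h a) (h b)"
      have "ba_le A a b" using le sub a b by (simp add: ba_iso_map_le[OF A h] subsetD)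
      then show "h b \<in> h ` \<Gamma>" using up[OF a b] by blast
    qed
    show "\<forall>a\<in>h ` carrier A. \<forall>b\<in>h ` carrier A. a \<oplus>\<^bsub>B\<^esub> b \<in> h ` \<Gamma> \<longrightarrow> a \<in> h ` \<Gamma> \<or> b \<in> h ` \<Gamma>"
      using join by (simp add: ba_iso_mapD(4)[OF h, symmetric] mem join_closed)
  qed
qed

lemma proper_filters_image:
  assumes A: "boolean_alg A" and h: "ba_iso_map A B h" and F: "F \<in> proper_filters A"
  shows "h ` F \<in> proper_filters B"
proof -
  interpret boolean_alg A by (rule A)
  have sub: "F \<subseteq> carrier A" and ne: "F \<noteq> {}" and z: "\<zero>\<^bsub>A\<^esub> \<notin> F"
    and up: "\<And>a b. \<lbrakk>a \<in> F; b \<in> carrier A; ba_le A a b\<rbrakk> \<Longrightarrow> b \<in> F"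
    and meet: "\<And>a b. \<lbrakk>a \<in> F; b \<in> F\<rbrakk> \<Longrightarrow> a \<otimes>\<^bsub>A\<^esub> b \<in> F"
    using F unfolding proper_filters_def by blast+
  note mem = ba_iso_map_image_mem_iff[OF h _ sub]
  show ?thesis
    unfolding proper_filters_def ba_iso_mapD(3)[OF h, symmetric]
  proof (rule CollectI, intro conjI)
    show "h ` F \<subseteq> h ` carrier A" "h ` F \<noteq> {}" using sub ne by blast+
    show "\<zero>\<^bsub>B\<^esub> \<notin> h ` F"
      using z mem[OF bot_closed] by (simp add: ba_iso_mapD(7)[OF h])
    show "\<forall>a\<in>h ` F. \<forall>b\<in>h ` carrier A. ba_le B a b \<longrightarrow> b \<in> h ` F"
      unfolding ball_simps(9)
    proof (intro ballI impI)
      fix a b assume a: "a \<in> F" and b: "b \<in> carrier A" and le: "ba_le B (h a) (h b)"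
      have "ba_le A a b" using le sub a b by (simp add: ba_iso_map_le[OF A h] subsetD)
      then show "h b \<in> h ` F" using up[OF a b] by blast
    qed
    show "\<forall>a\<in>h ` F. \<forall>b\<in>h ` F. a \<otimes>\<^bsub>B\<^esub> b \<in> h ` F"
      using sub meet by (auto simp: ba_iso_mapD(5)[OF h, symmetric] subsetD)
  qed
qed

lemma inv_into_image_image:
  "\<lbrakk>bij_betw h C D; S \<subseteq> D\<rbrakk> \<Longrightarrow> h ` inv_into C h ` S = S"
  by (metis bij_betw_imp_surj_on image_inv_into_cancel)

text \<open>A proper filter above the image of \<open>U\<close> pulls back along the inverse
  isomorphism to a proper filter above \<open>U\<close>, where maximality applies.\<close>

lemma Ult_image:
  assumes A: "boolean_alg A" and h: "ba_iso_map A B h" and U: "U \<in> Ult A"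
  shows "h ` U \<in> Ult B"
proof -
  have UF: "U \<in> proper_filters A" and max: "\<And>F. \<lbrakk>F \<in> proper_filters A; U \<subseteq> F\<rbrakk> \<Longrightarrow> F = U"
    using U by (auto simp: Ult_def)
  let ?k = "inv_into (carrier A) h"
  have "F = h ` U" if F: "F \<in> proper_filters B" and UF': "h ` U \<subseteq> F" for F
  proof -
    have k: "ba_iso_map B A ?k" and B: "boolean_alg B"
      using A h by (rule ba_iso_map_inv_into ba_iso_map_boolean_alg)+
    have "?k ` h ` U = U"
      using UF ba_iso_mapD(2)[OF h] by (simp add: proper_filters_def inv_into_image_cancel)
    then have "U \<subseteq> ?k ` F" using UF' by blast
    then have "?k ` F = U" by (rule max[OF proper_filters_image[OF B k F]])
    moreover have "h ` ?k ` F = F"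
      using F by (intro inv_into_image_image[OF ba_iso_mapD(1)[OF h]]) (simp add: proper_filters_def)
    ultimately show ?thesis by simp
  qed
  then show ?thesis using proper_filters_image[OF A h UF] by (simp add: Ult_def)
qed

section \<open>Homeomorphisms and closed bases\<close>

lemma closedin_closed_base_iff:
  assumes "closed_base X \<C>"
  shows "closedin X F \<longleftrightarrow> (\<exists>\<D>\<subseteq>\<C>. F = topspace X \<inter> \<Inter>\<D>)"
proof
  assume "\<exists>\<D>\<subseteq>\<C>. F = topspace X \<inter> \<Inter>\<D>"
  \<comment> \<open>Inserting \<open>topspace X\<close> keeps the intersected family nonempty, as
    \<open>closedin_Inter\<close> requires.\<close>
  then obtain \<D> where D: "\<D> \<subseteq> \<C>" "F = \<Inter>(insert (topspace X) \<D>)" by auto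
  have "closedin X S" if "S \<in> insert (topspace X) \<D>" for S
    using that D(1) assms by (auto simp: closed_base_def)
  then show "closedin X F" unfolding D(2) by (intro closedin_Inter) simp_all
qed (use assms in \<open>simp add: closed_base_def\<close>)

text \<open>Every closed set is an intersection of basic ones, and a bijection commutes with
  intersections. Matching the bases therefore makes \<open>f\<close> continuous and closed.\<close>

lemma homeomorphic_map_closed_base:
  assumes X: "closed_base X \<C>" and Y: "closed_base Y ((`) f ` \<C>)"
    and bij: "bij_betw f (topspace X) (topspace Y)"
  shows "homeomorphic_map X Y f"
proof (rule bijective_closed_imp_homeomorphic_map)
  have inj: "inj_on f (topspace X)" and surj: "f ` topspace X = topspace Y"
    using bij by (simp_all add: bij_betw_def)
  then show "f ` topspace X = topspace Y" "inj_on f (topspace X)" by simp_all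
  have sub: "K \<subseteq> topspace X" if "K \<in> \<C>" for K
    using X that closedin_subset by (auto simp: closed_base_def)
  have mem: "f x \<in> f ` K \<longleftrightarrow> x \<in> K" if "x \<in> topspace X" "K \<in> \<C>" for x K
    using inj_on_image_mem_iff[OF inj that(1) sub[OF that(2)]] .
  have image_preimage: "f ` {x \<in> topspace X. f x \<in> topspace Y \<inter> S} = topspace Y \<inter> S" for S
    unfolding surj[symmetric] by auto
  have preimage: "{x \<in> topspace X. f x \<in> topspace Y \<inter> \<Inter>((`) f ` \<D>)} = topspace X \<inter> \<Inter>\<D>"
    if "\<D> \<subseteq> \<C>" for \<D>
    using mem that surj by (auto simp: subset_iff)
  show "continuous_map X Y f"
    unfolding continuous_map_closedin
  proof (intro conjI allI impI)
    show "f \<in> topspace X \<rightarrow> topspace Y" using surj by blast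
    fix C assume "closedin Y C"
    then obtain \<D> where D: "\<D> \<subseteq> \<C>" "C = topspace Y \<inter> \<Inter>((`) f ` \<D>)"
      unfolding closedin_closed_base_iff[OF Y] by (auto simp: subset_image_iff)
    show "closedin X {x \<in> topspace X. f x \<in> C}"
      unfolding D(2) preimage[OF D(1)] closedin_closed_base_iff[OF X]
      using D(1) by (intro exI[of _ \<D>] conjI refl)
  qed
  show "closed_map X Y f"
    unfolding closed_map_def
  proof (intro allI impI)
    fix F assume "closedin X F"
    then obtain \<D> where D: "\<D> \<subseteq> \<C>" "F = topspace X \<inter> \<Inter>\<D>"
      unfolding closedin_closed_base_iff[OF X] by blast
    have "f ` F = f ` {x \<in> topspace X. f x \<in> topspace Y \<inter> \<Inter>((`) f ` \<D>)}"
      unfolding preimage[OF D(1)] D(2) ..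
    also have "\<dots> = topspace Y \<inter> \<Inter>((`) f ` \<D>)" by (rule image_preimage)
    finally show "closedin Y (f ` F)"
      unfolding closedin_closed_base_iff[OF Y]
      using image_mono[OF D(1)] by (intro exI[of _ "(`) f ` \<D>"] conjI)
  qed
qed

lemma S2S_isomorphic_sym:
  assumes X0: "X0 \<subseteq> topspace X" and iso: "S2S_isomorphic X X0 Y Y0"
  shows "S2S_isomorphic Y Y0 X X0"
proof -
  obtain f where f: "homeomorphic_map X Y f" "f ` X0 = Y0"
    using iso by (auto simp: S2S_isomorphic_def)
  then obtain g where g: "homeomorphic_maps X Y f g" by (auto simp: homeomorphic_map_maps)
  then have "homeomorphic_map Y X g"
    using homeomorphic_maps_map homeomorphic_maps_sym by blast
  moreover have "g ` Y0 = X0"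
  proof -
    have "g (f x) = x" if "x \<in> X0" for x using g X0 that by (auto simp: homeomorphic_maps_def)
    then show ?thesis unfolding f(2)[symmetric] image_image by simp
  qed
  ultimately show ?thesis unfolding S2S_isomorphic_def by blast
qed

lemma S2S_isomorphic_trans:
  "\<lbrakk>S2S_isomorphic X X0 Y Y0; S2S_isomorphic Y Y0 Z Z0\<rbrakk> \<Longrightarrow> S2S_isomorphic X X0 Z Z0"
  unfolding S2S_isomorphic_def by (metis homeomorphic_map_compose image_comp)

section \<open>From isomorphic algebras to isomorphic spaces and back\<close>

lemma image_canonical_g:
  assumes A: "boolean_alg A" and h: "ba_iso_map A B h" and a: "a \<in> carrier A"
  shows "(`) h ` canonical_g A a = canonical_g B (h a)"
proof -
  let ?k = "inv_into (carrier A) h"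
  have B: "boolean_alg B" and k: "ba_iso_map B A ?k"
    using A h by (rule ba_iso_map_boolean_alg ba_iso_map_inv_into)+
  have "\<Gamma> \<in> (`) h ` {\<Gamma> \<in> Grills A. a \<in> \<Gamma>}" if G: "\<Gamma> \<in> Grills B" "h a \<in> \<Gamma>" for \<Gamma>
  proof (rule image_eqI)
    show "\<Gamma> = h ` ?k ` \<Gamma>"
      using G(1) inv_into_image_image[OF ba_iso_mapD(1)[OF h]] by (simp add: Grills_def)
    have "a = ?k (h a)" using a ba_iso_mapD(2)[OF h] by simp
    then show "?k ` \<Gamma> \<in> {\<Gamma> \<in> Grills A. a \<in> \<Gamma>}"
      using Grills_image[OF B k G(1)] G(2) by blast
  qed
  then show ?thesis
    using Grills_image[OF A h]
    by (auto simp: canonical_g_def boolean_alg.canonical_points_eq_Grills[OF A]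
        boolean_alg.canonical_points_eq_Grills[OF B])
qed

text \<open>The homeomorphism takes direct images of grills under \<open>h\<close>. It matches the
  closed bases by \<open>image_canonical_g\<close>, and \<open>Ult_image\<close> for
  \<open>h\<close> and its inverse handles the ultrafilters.\<close>

lemma S2S_isomorphic_canonical:
  assumes A: "boolean_alg A" and iso: "ba_isomorphic A B"
  shows "S2S_isomorphic (canonical_topology A) (Ult A) (canonical_topology B) (Ult B)"
proof -
  obtain h where h: "ba_iso_map A B h" using iso by (auto simp: ba_isomorphic_def)
  let ?k = "inv_into (carrier A) h"
  have B: "boolean_alg B" and k: "ba_iso_map B A ?k"
    using A h by (rule ba_iso_map_boolean_alg ba_iso_map_inv_into)+
  interpret A: boolean_alg A by (rule A)
  interpret B: boolean_alg B by (rule B)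
  have "inj_on ((`) h) (Grills A)"
    using inj_on_image_Pow[OF ba_iso_mapD(2)[OF h]] by (rule inj_on_subset) (auto simp: Grills_def)
  \<comment> \<open>The case \<open>\<one>\<close> of \<open>image_canonical_g\<close>, since
    \<open>canonical_g\<close> at the unit is the set of all grills.\<close>
  moreover have "(`) h ` Grills A = Grills B"
    using image_canonical_g[OF A h A.top_closed]
    by (simp add: A.canonical_g_top B.canonical_g_top ba_iso_mapD(8)[OF h]
        A.canonical_points_eq_Grills B.canonical_points_eq_Grills)
  ultimately have bij: "bij_betw ((`) h) (Grills A) (Grills B)" by (simp add: bij_betw_def)
  have base: "(`) ((`) h) ` canonical_g A ` carrier A = canonical_g B ` carrier B"
    unfolding ba_iso_mapD(3)[OF h, symmetric] image_image
    by (intro image_cong refl image_canonical_g[OF A h])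
  have "homeomorphic_map (canonical_topology A) (canonical_topology B) ((`) h)"
    by (rule homeomorphic_map_closed_base[OF A.closed_base_canonical_topology])
      (simp_all add: base B.closed_base_canonical_topology bij A.topspace_canonical_topology
        B.topspace_canonical_topology A.canonical_points_eq_Grills B.canonical_points_eq_Grills)
  moreover have "(`) h ` Ult A = Ult B"
  proof
    show "(`) h ` Ult A \<subseteq> Ult B" using Ult_image[OF A h] by blast
    show "Ult B \<subseteq> (`) h ` Ult A"
    proof
      fix U assume U: "U \<in> Ult B"
      then have "U = h ` ?k ` U"
        using inv_into_image_image[OF ba_iso_mapD(1)[OF h]]
        by (simp add: Ult_def proper_filters_def)
      then show "U \<in> (`) h ` Ult A" using Ult_image[OF B k U] by blast
    qed
  qed
  ultimately show ?thesis unfolding S2S_isomorphic_def by blast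
qed

lemma homeomorphic_map_image_CO:
  assumes f: "homeomorphic_map X Y f"
  shows "carrier (CO Y) = (`) f ` carrier (CO X)"
proof
  show "(`) f ` carrier (CO X) \<subseteq> carrier (CO Y)"
    using homeomorphic_map_openness_eq[OF f] homeomorphic_map_closedness_eq[OF f]
    by (auto simp: CO_def)
  show "carrier (CO Y) \<subseteq> (`) f ` carrier (CO X)"
  proof
    fix C assume C: "C \<in> carrier (CO Y)"
    then have "C \<subseteq> f ` topspace X"
      using openin_subset homeomorphic_imp_surjective_map[OF f] by (fastforce simp: CO_def)
    then obtain D where D: "D \<subseteq> topspace X" "C = f ` D" by (rule subset_imageE)
    then have "D \<in> carrier (CO X)"
      using C homeomorphic_map_openness[OF f] homeomorphic_map_closedness[OF f]
      by (simp add: CO_def)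
    then show "C \<in> (`) f ` carrier (CO X)" using D(2) by blast
  qed
qed

text \<open>A homeomorphism of pairs carries clopen sets of the subspaces to each other and commutes
  with closure and interior, hence direct image respects all operations.\<close>

lemma ba_isomorphic_RC_pair:
  assumes X0: "X0 \<subseteq> topspace X" and iso: "S2S_isomorphic X X0 Y Y0"
  shows "ba_isomorphic (RC_pair X X0) (RC_pair Y Y0)"
proof -
  obtain f where f: "homeomorphic_map X Y f" "f ` X0 = Y0"
    using iso by (auto simp: S2S_isomorphic_def)
  have inj: "inj_on f (topspace X)" and surj: "f ` topspace X = topspace Y"
    using homeomorphic_imp_injective_map[OF f(1)] homeomorphic_imp_surjective_map[OF f(1)] .
  have "homeomorphic_map (subtopology X X0) (subtopology Y Y0) f"
    using X0 surj f(2) by (intro homeomorphic_map_subtopologies[OF f(1)]) (auto simp: Int_absorb1)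
  then have CO: "carrier (CO (subtopology Y Y0)) = (`) f ` carrier (CO (subtopology X X0))"
    by (rule homeomorphic_map_image_CO)
  have COsub: "C \<subseteq> topspace X" if "C \<in> carrier (CO (subtopology X X0))" for C
    using that openin_subset[of "subtopology X X0" C] by (simp add: CO_def)
  have car: "carrier (RC_pair Y Y0) = (`) f ` carrier (RC_pair X X0)"
    using COsub
    by (simp add: RC_pair_def CO image_image homeomorphic_map_closure_of[OF f(1)] cong: image_cong)
  have sub: "a \<subseteq> topspace X" if "a \<in> carrier (RC_pair X X0)" for a
    using that closure_of_subset_topspace by (fastforce simp: RC_pair_def)
  have cl: "f ` (X closure_of S) = Y closure_of (f ` S)"
    and int: "f ` (X interior_of S) = Y interior_of (f ` S)" if "S \<subseteq> topspace X" for S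
    using homeomorphic_map_closure_of[OF f(1) that] homeomorphic_map_interior_of[OF f(1) that]
    by simp_all
  have "ba_iso_map (RC_pair X X0) (RC_pair Y Y0) ((`) f)"
    unfolding ba_iso_map_def bij_betw_def
  proof (intro conjI ballI)
    show "inj_on ((`) f) (carrier (RC_pair X X0))"
      by (rule inj_on_subset[OF inj_on_image_Pow[OF inj]]) (use sub in blast)
    show "(`) f ` carrier (RC_pair X X0) = carrier (RC_pair Y Y0)" by (simp add: car)
  next
    fix a b assume ab: "a \<in> carrier (RC_pair X X0)" "b \<in> carrier (RC_pair X X0)"
    show "f ` (a \<oplus>\<^bsub>RC_pair X X0\<^esub> b) = f ` a \<oplus>\<^bsub>RC_pair Y Y0\<^esub> f ` b"
      by (simp add: RC_pair_def RC_def image_Un)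
    have "a \<inter> b \<subseteq> topspace X" using sub[OF ab(1)] by blast
    then show "f ` (a \<otimes>\<^bsub>RC_pair X X0\<^esub> b) = f ` a \<otimes>\<^bsub>RC_pair Y Y0\<^esub> f ` b"
      using inj_on_image_Int[OF inj sub[OF ab(1)] sub[OF ab(2)]]
      by (simp add: RC_pair_def RC_def cl int interior_of_subset_topspace)
  next
    fix a assume a: "a \<in> carrier (RC_pair X X0)"
    show "f ` bcompl (RC_pair X X0) a = bcompl (RC_pair Y Y0) (f ` a)"
      using inj_on_image_set_diff[OF inj _ sub[OF a], of "topspace X"]
      by (simp add: RC_pair_def RC_def cl surj)
  qed (simp_all add: RC_pair_def RC_def surj)
  then show ?thesis unfolding ba_isomorphic_def by blast
qed

section \<open>Closure as an isomorphism on the clopen sets of a dense subspace\<close>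

text \<open>A clopen set of the subspace is relatively closed, so the trace of its closure gives it
  back. This is the source of injectivity of closure.\<close>

lemma Int_closure_of_CO:
  assumes A: "A \<in> carrier (CO (subtopology X X0))"
  shows "X0 \<inter> X closure_of A = A"
proof -
  have cl: "closedin (subtopology X X0) A" using A by (simp add: CO_def)
  then have "A \<subseteq> X0" using closedin_subset by fastforce
  then show ?thesis
    using closure_of_closedin[OF cl] by (simp add: closure_of_subtopology Int_absorb1)
qed

lemma boolean_alg_CO: "boolean_alg (CO X)"
  by standard (auto simp: CO_def dest: openin_subset)

lemma ba_iso_map_closure_of:
  assumes "topological_pair X X0"
  shows "ba_iso_map (CO (subtopology X X0)) (RC_pair X X0) (\<lambda>A. X closure_of A)"
proof -
  let ?S = "subtopology X X0"
  have X0: "X0 \<subseteq> topspace X" and dense: "X closure_of X0 = topspace X"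
    using assms by (simp_all add: topological_pair_def)
  have top: "topspace ?S = X0" using X0 by (simp add: Int_absorb1)
  \<comment> \<open>By density an open set has the same closure as its trace on \<open>X0\<close>;
    here that trace is \<open>X0 - A\<close>.\<close>
  have compl: "X closure_of (topspace X - X closure_of A) = X closure_of (X0 - A)"
    if "A \<in> carrier (CO ?S)" for A
  proof -
    have "X closure_of (topspace X - X closure_of A) =
        X closure_of ((topspace X - X closure_of A) \<inter> X0)"
      by (rule closure_of_openin_Int_superset[symmetric]) (simp add: dense openin_diff)
    also have "(topspace X - X closure_of A) \<inter> X0 = X0 - A"
      using X0 Int_closure_of_CO[OF that] by blast
    finally show ?thesis .
  qed
  interpret boolean_alg "CO ?S" by (rule boolean_alg_CO)
  have diff: "X0 - A \<in> carrier (CO ?S)" if "A \<in> carrier (CO ?S)" for A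
    using compl_closed[OF that] top by (simp add: CO_def)
  have int: "X interior_of (X closure_of A) = topspace X - X closure_of (X0 - A)"
    if "A \<in> carrier (CO ?S)" for A
    unfolding interior_of_closure_of compl[OF that] ..
  show ?thesis
    unfolding ba_iso_map_def bij_betw_def
  proof (intro conjI ballI)
    show "inj_on (\<lambda>A. X closure_of A) (carrier (CO ?S))"
      by (rule inj_onI) (metis Int_closure_of_CO)
    show "(\<lambda>A. X closure_of A) ` carrier (CO ?S) = carrier (RC_pair X X0)"
      by (simp add: RC_pair_def)
    show "X closure_of \<zero>\<^bsub>CO ?S\<^esub> = \<zero>\<^bsub>RC_pair X X0\<^esub>" "X closure_of \<one>\<^bsub>CO ?S\<^esub> = \<one>\<^bsub>RC_pair X X0\<^esub>"
      using dense top by (simp_all add: RC_pair_def RC_def CO_def)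
  next
    fix A assume "A \<in> carrier (CO ?S)"
    then show "X closure_of bcompl (CO ?S) A = bcompl (RC_pair X X0) (X closure_of A)"
      using compl top by (simp add: RC_pair_def RC_def CO_def)
  next
    fix A C assume AC: "A \<in> carrier (CO ?S)" "C \<in> carrier (CO ?S)"
    show "X closure_of (A \<oplus>\<^bsub>CO ?S\<^esub> C) = X closure_of A \<oplus>\<^bsub>RC_pair X X0\<^esub> X closure_of C"
      by (simp add: RC_pair_def RC_def CO_def closure_of_Un)
    have AC': "A \<inter> C \<in> carrier (CO ?S)" using meet_closed[OF AC] by (simp add: CO_def)
    \<comment> \<open>Both interiors are complements of closures by \<open>int\<close>, so the meet
      reduces to a union of relative complements, with which closure commutes.\<close>
    have "X interior_of (X closure_of A \<inter> X closure_of C) =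
        topspace X - X closure_of ((X0 - A) \<union> (X0 - C))"
      unfolding interior_of_Int int[OF AC(1)] int[OF AC(2)] closure_of_Un by blast
    also have "\<dots> = topspace X - X closure_of (X0 - A \<inter> C)" by (simp add: Diff_Int)
    finally have "X closure_of (X interior_of (X closure_of A \<inter> X closure_of C)) =
        X closure_of (X0 - (X0 - A \<inter> C))"
      by (simp add: compl[OF diff[OF AC']])
    also have "X0 - (X0 - A \<inter> C) = A \<inter> C"
      using openin_subset[of ?S "A \<inter> C"] AC' top by (auto simp: CO_def)
    finally show "X closure_of (A \<otimes>\<^bsub>CO ?S\<^esub> C) = X closure_of A \<otimes>\<^bsub>RC_pair X X0\<^esub> X closure_of C"
      by (simp add: RC_pair_def RC_def CO_def)
  qed
qed

lemma boolean_alg_RC_pair: "topological_pair X X0 \<Longrightarrow> boolean_alg (RC_pair X X0)"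
  using boolean_alg_CO ba_iso_map_closure_of by (rule ba_iso_map_boolean_alg)

section \<open>A Stone 2-space as the space of grills of its algebra\<close>

lemma S2S_isomorphic_canonical_RC_pair:
  assumes S2: "stone_2_space X X0"
  shows "S2S_isomorphic X X0 (canonical_topology (RC_pair X X0)) (Ult (RC_pair X X0))"
proof -
  let ?R = "RC_pair X X0" and ?C = "CO (subtopology X X0)"
  have pair: "topological_pair X X0" and t0: "t0_space X"
    and compact: "compact_space (subtopology X X0)" and base: "closed_base X (carrier ?R)"
    and grill: "\<And>\<Gamma>. \<Gamma> \<in> Grills ?C \<Longrightarrow> \<exists>x\<in>topspace X. \<Gamma> = point_grill X X0 x"
    using S2 by (simp_all add: stone_2_space_def stone_space_def)
  have X0: "X0 \<subseteq> topspace X" using pair by (simp add: topological_pair_def)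
  note iso = ba_iso_map_closure_of[OF pair]
  interpret C: boolean_alg ?C by (rule boolean_alg_CO)
  interpret R: boolean_alg ?R by (rule boolean_alg_RC_pair[OF pair])
  have carR: "carrier ?R = (\<lambda>A. X closure_of A) ` carrier ?C" by (simp add: RC_pair_def)
  have closed: "closedin X F" if "F \<in> carrier ?R" for F using that by (auto simp: carR)
  have sub: "F \<subseteq> topspace X" if "F \<in> carrier ?R" for F
    using closedin_subset[OF closed[OF that]] .
  \<comment> \<open>The meet in \<open>?R\<close> is not the intersection, but it is contained in it
    because \<open>F\<close> and \<open>G\<close> are closed.\<close>
  have le: "F \<subseteq> G" if "F \<in> carrier ?R" "G \<in> carrier ?R" "ba_le ?R F G" for F G
  proof -
    have "F = X closure_of (X interior_of (F \<inter> G))"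
      using that(3) by (simp add: ba_le_def RC_pair_def RC_def)
    also have "\<dots> \<subseteq> F \<inter> G"
      using that by (intro closure_of_minimal interior_of_subset closedin_Int closed)
    finally show ?thesis by blast
  qed
  define \<phi> where "\<phi> x = {F \<in> carrier ?R. x \<in> F}" for x
  have phi_grill: "\<phi> x \<in> Grills ?R" if x: "x \<in> topspace X" for x
    unfolding Grills_def
  proof (rule CollectI, intro conjI ballI impI)
    have "topspace X \<in> carrier ?R" using R.top_closed by (simp add: RC_pair_def RC_def)
    then show "\<phi> x \<noteq> {}" using x by (auto simp: \<phi>_def)
    show "\<phi> x \<subseteq> carrier ?R" "\<zero>\<^bsub>?R\<^esub> \<notin> \<phi> x" by (auto simp: \<phi>_def RC_pair_def RC_def)
    show "G \<in> \<phi> x" if "F \<in> \<phi> x" "G \<in> carrier ?R" "ba_le ?R F G" for F G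
      using that le[of F G] by (auto simp: \<phi>_def)
    show "F \<in> \<phi> x \<or> G \<in> \<phi> x"
      if "F \<in> carrier ?R" "G \<in> carrier ?R" "F \<oplus>\<^bsub>?R\<^esub> G \<in> \<phi> x" for F G
      using that by (auto simp: \<phi>_def RC_pair_def RC_def)
  qed
  have "inj_on \<phi> (topspace X)"
  proof (rule inj_onI, rule ccontr)
    fix x y assume xy: "x \<in> topspace X" "y \<in> topspace X" "\<phi> x = \<phi> y" "x \<noteq> y"
    then obtain U where U: "openin X U" "x \<notin> U \<longleftrightarrow> y \<in> U"
      using t0 unfolding t0_space_def by blast
    then have "closedin X (topspace X - U)" by blast
    \<comment> \<open>The complement of the separating open set is an intersection of members of
      \<open>?R\<close>, and each of these contains both points or neither because
      \<open>\<phi> x = \<phi> y\<close>.\<close>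
    then obtain \<D> where D: "\<D> \<subseteq> carrier ?R" "topspace X - U = topspace X \<inter> \<Inter>\<D>"
      unfolding closedin_closed_base_iff[OF base] by blast
    have "x \<in> F \<longleftrightarrow> y \<in> F" if "F \<in> \<D>" for F
      using xy(3) D(1) that by (auto simp: \<phi>_def)
    then have "x \<in> topspace X - U \<longleftrightarrow> y \<in> topspace X - U" unfolding D(2) using xy(1,2) by blast
    then show False using U(2) xy(1,2) by blast
  qed
  moreover have surj: "\<phi> ` topspace X = Grills ?R"
  proof
    show "\<phi> ` topspace X \<subseteq> Grills ?R" using phi_grill by blast
    show "Grills ?R \<subseteq> \<phi> ` topspace X"
    proof
      fix G assume G: "G \<in> Grills ?R"
      let ?k = "inv_into (carrier ?C) (\<lambda>A. X closure_of A)"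
      \<comment> \<open>(S2S4) concerns grills of clopen sets, so \<open>G\<close> is first pulled
        back along closure; taking closures again turns the resulting \<open>point_grill\<close>
        into \<open>\<phi> x\<close>.\<close>
      have "?k ` G \<in> Grills ?C"
        by (rule Grills_image[OF R.boolean_alg_axioms ba_iso_map_inv_into[OF boolean_alg_CO iso] G])
      then obtain x where x: "x \<in> topspace X" "?k ` G = point_grill X X0 x" using grill by blast
      have "G = (\<lambda>A. X closure_of A) ` ?k ` G"
        using G by (intro inv_into_image_image[OF ba_iso_mapD(1)[OF iso], symmetric])
          (simp add: Grills_def)
      also have "\<dots> = \<phi> x" unfolding x(2) by (auto simp: point_grill_def \<phi>_def carR)
      finally show "G \<in> \<phi> ` topspace X" using x(1) by blast
    qed
  qed
  ultimately have bij: "bij_betw \<phi> (topspace X) (Grills ?R)" by (simp add: bij_betw_def)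
  have "\<phi> ` F = canonical_g ?R F" if F: "F \<in> carrier ?R" for F
    unfolding canonical_g_def R.canonical_points_eq_Grills surj[symmetric]
    using F sub[OF F] by (auto simp: \<phi>_def)
  then have "(`) \<phi> ` carrier ?R = canonical_g ?R ` carrier ?R" by (intro image_cong refl)
  then have "homeomorphic_map X (canonical_topology ?R) \<phi>"
    using bij R.closed_base_canonical_topology
    by (intro homeomorphic_map_closed_base[OF base])
      (simp_all add: R.topspace_canonical_topology R.canonical_points_eq_Grills)
  moreover have "\<phi> ` X0 = Ult ?R"
  proof
    \<comment> \<open>On points of \<open>X0\<close> the closure adds nothing to a clopen set, so
      there \<open>\<phi> x\<close> behaves like the family of clopen sets containing
      \<open>x\<close>, which is an ultrafilter.\<close>
    have mem: "X closure_of A \<in> \<phi> x \<longleftrightarrow> x \<in> A" if "A \<in> carrier ?C" "x \<in> X0" for A x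
      using that Int_closure_of_CO[OF that(1)] by (auto simp: \<phi>_def carR)
    have Ult: "\<phi> x \<in> Ult ?R" if x: "x \<in> X0" for x
    proof (rule R.UltI)
      have grill: "\<phi> x \<in> Grills ?R" using phi_grill X0 x by blast
      have "F \<otimes>\<^bsub>?R\<^esub> G \<in> \<phi> x" if "F \<in> \<phi> x" "G \<in> \<phi> x" for F G
      proof -
        have "F \<in> carrier ?R" "G \<in> carrier ?R" using that by (simp_all add: \<phi>_def)
        then obtain A D where A: "A \<in> carrier ?C" "F = X closure_of A"
          and D: "D \<in> carrier ?C" "G = X closure_of D" unfolding carR by blast
        have "x \<in> A" "x \<in> D"
          using that mem[OF A(1) x] mem[OF D(1) x] A(2) D(2) by simp_all
        then have "x \<in> A \<otimes>\<^bsub>?C\<^esub> D" by (simp add: CO_def)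
        then show ?thesis
          using mem[OF C.meet_closed[OF A(1) D(1)] x] ba_iso_mapD(5)[OF iso A(1) D(1)]
          by (simp add: A(2) D(2))
      qed
      with grill show "\<phi> x \<in> proper_filters ?R" unfolding Grills_def proper_filters_def by blast
      fix F assume "F \<in> carrier ?R"
      then obtain A where A: "A \<in> carrier ?C" "F = X closure_of A" unfolding carR by blast
      have "x \<in> A \<or> x \<in> bcompl ?C A" using x X0 by (auto simp: CO_def)
      then show "F \<in> \<phi> x \<or> bcompl ?R F \<in> \<phi> x"
        using mem[OF A(1) x] mem[OF C.compl_closed[OF A(1)] x] ba_iso_mapD(6)[OF iso A(1)]
        by (simp add: A(2))
    qed
    then show "\<phi> ` X0 \<subseteq> Ult ?R" by blast
    show "Ult ?R \<subseteq> \<phi> ` X0"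
    proof
      fix U assume U: "U \<in> Ult ?R"
      then have UF: "U \<in> proper_filters ?R" by (simp add: Ult_def)
      \<comment> \<open>The ultrafilter seen in the clopen algebra. Its finite intersections are
        nonempty, so compactness of \<open>X0\<close> provides a common point
        \<open>x\<close>.\<close>
      define \<U> where "\<U> = {A \<in> carrier ?C. X closure_of A \<in> U}"
      have X0U: "X0 \<in> \<U>"
        using C.top_closed ba_iso_mapD(8)[OF iso] R.proper_filterD(3)[OF UF] X0
        by (simp add: \<U>_def CO_def Int_absorb1)
      have Int: "A \<inter> D \<in> \<U>" if "A \<in> \<U>" "D \<in> \<U>" for A D
        using that C.meet_closed[of A D] ba_iso_mapD(5)[OF iso, of A D] R.proper_filterD(5)[OF UF]
        by (simp add: \<U>_def CO_def)
      \<comment> \<open>Intersecting with \<open>X0\<close> makes the base case true, where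
        \<open>\<Inter>{}\<close> is \<open>UNIV\<close>.\<close>
      have finInt: "X0 \<inter> \<Inter>\<F> \<in> \<U>" if "finite \<F>" "\<F> \<subseteq> \<U>" for \<F>
        using that
      proof (induction \<F>)
        case empty
        show ?case using X0U by simp
      next
        case (insert A \<F>)
        then show ?case using Int[of A "X0 \<inter> \<Inter>\<F>"] by (simp add: Int_left_commute)
      qed
      have "{} \<notin> \<U>"
        using R.proper_filterD(2)[OF UF] by (simp add: \<U>_def RC_pair_def RC_def)
      then have "\<Inter>\<F> \<noteq> {}" if "finite \<F>" "\<F> \<subseteq> \<U>" for \<F>
        using finInt[OF that] by auto
      moreover have "closedin (subtopology X X0) A" if "A \<in> \<U>" for A
        using that by (simp add: \<U>_def CO_def)
      ultimately have "\<Inter>\<U> \<noteq> {}"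
        by (intro compact[unfolded compact_space_fip, rule_format]) simp
      then obtain x where x: "\<And>A. A \<in> \<U> \<Longrightarrow> x \<in> A" by blast
      then have x0: "x \<in> X0" using X0U by blast
      have "F \<in> \<phi> x" if F: "F \<in> U" for F
      proof -
        have "F \<in> carrier ?R" using F R.proper_filterD(1)[OF UF] by blast
        then obtain A where A: "A \<in> carrier ?C" "F = X closure_of A" unfolding carR by blast
        then have "x \<in> A" using F x by (simp add: \<U>_def)
        then show ?thesis using mem[OF A(1) x0] A(2) by simp
      qed
      \<comment> \<open>One inclusion suffices, since comparable ultrafilters coincide.\<close>
      then have "U = \<phi> x" by (intro R.ultrafilter_eqI[OF U Ult[OF x0]]) blast
      then show "U \<in> \<phi> ` X0" using x0 by blast
    qed
  qed
  ultimately show ?thesis unfolding S2S_isomorphic_def by blast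
qed

section \<open>The correspondence of isomorphism classes\<close>

lemma stone_2_space_imp_subset: "stone_2_space X X0 \<Longrightarrow> X0 \<subseteq> topspace X"
  by (simp add: stone_2_space_def topological_pair_def)

lemma stone_2_space_imp_boolean_alg: "stone_2_space X X0 \<Longrightarrow> boolean_alg (RC_pair X X0)"
  by (simp add: stone_2_space_def boolean_alg_RC_pair)

lemma ba_isomorphic_RC_pair_canonical:
  assumes "boolean_alg B"
  shows "ba_isomorphic B (RC_pair (canonical_topology B) (Ult B))"
  using boolean_alg.ba_iso_map_canonical_g[OF assms] unfolding ba_isomorphic_def by blast

text \<open>For the converse, \<open>B\<close> and \<open>B'\<close> are each isomorphic to the
  algebra of their canonical space, and isomorphic spaces have isomorphic algebras.\<close>

lemma ba_isomorphic_iff_S2S_isomorphic_canonical: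
  assumes B: "boolean_alg B" and B': "boolean_alg B'"
  shows "ba_isomorphic B B' \<longleftrightarrow>
    S2S_isomorphic (canonical_topology B) (Ult B) (canonical_topology B') (Ult B')"
proof
  assume "S2S_isomorphic (canonical_topology B) (Ult B) (canonical_topology B') (Ult B')"
  then have "ba_isomorphic (RC_pair (canonical_topology B) (Ult B))
      (RC_pair (canonical_topology B') (Ult B'))"
    by (rule ba_isomorphic_RC_pair[OF
          stone_2_space_imp_subset[OF boolean_alg.stone_2_space_canonical[OF B]]])
  then have "ba_isomorphic B (RC_pair (canonical_topology B') (Ult B'))"
    by (rule ba_isomorphic_trans[OF ba_isomorphic_RC_pair_canonical[OF B]])
  then show "ba_isomorphic B B'"
    by (rule ba_isomorphic_trans[OF _ ba_isomorphic_sym[OF B' ba_isomorphic_RC_pair_canonical[OF B']]])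
qed (rule S2S_isomorphic_canonical[OF B])

text \<open>The dual chain: each space is isomorphic to the canonical space of its algebra, and
  isomorphic algebras have isomorphic canonical spaces.\<close>

lemma S2S_isomorphic_iff_ba_isomorphic_RC_pair:
  assumes X: "stone_2_space X X0" and Y: "stone_2_space Y Y0"
  shows "S2S_isomorphic X X0 Y Y0 \<longleftrightarrow> ba_isomorphic (RC_pair X X0) (RC_pair Y Y0)"
proof
  assume "ba_isomorphic (RC_pair X X0) (RC_pair Y Y0)"
  then have "S2S_isomorphic (canonical_topology (RC_pair X X0)) (Ult (RC_pair X X0))
      (canonical_topology (RC_pair Y Y0)) (Ult (RC_pair Y Y0))"
    by (rule S2S_isomorphic_canonical[OF stone_2_space_imp_boolean_alg[OF X]])
  then have "S2S_isomorphic X X0 (canonical_topology (RC_pair Y Y0)) (Ult (RC_pair Y Y0))"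
    by (rule S2S_isomorphic_trans[OF S2S_isomorphic_canonical_RC_pair[OF X]])
  then show "S2S_isomorphic X X0 Y Y0"
    by (rule S2S_isomorphic_trans[OF _
          S2S_isomorphic_sym[OF stone_2_space_imp_subset[OF Y] S2S_isomorphic_canonical_RC_pair[OF Y]]])
qed (rule ba_isomorphic_RC_pair[OF stone_2_space_imp_subset[OF X]])

text \<open>The bijection between classes is unfolded into its ingredients. The equivalences make
  both maps well defined and injective on isomorphism classes, and the last two clauses make them
  mutually inverse. Separate type variables appear because each construction changes the underlying
  type.\<close>

theorem theorem8p7:
  shows
   "(\<forall>B :: 'a boolalg. boolean_alg B \<longrightarrow>
       ba_iso_map B (RC_pair (canonical_topology B) (Ult B)) (canonical_g B) \<and>
       (carrier (RC_pair (canonical_topology B) (Ult B)) = carrier (RC (canonical_topology B))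
          \<longleftrightarrow> ba_complete B)) \<and>
    (\<forall>B :: 'a boolalg. boolean_alg B \<longrightarrow>
       stone_2_space (canonical_topology B) (Ult B)) \<and>
    (\<forall>(X :: 'x topology) X0. stone_2_space X X0 \<longrightarrow>
       boolean_alg (RC_pair X X0)) \<and>
    (\<forall>(B :: 'a boolalg) (B' :: 'b boolalg). boolean_alg B \<and> boolean_alg B' \<longrightarrow>
       (ba_isomorphic B B' \<longleftrightarrow>
        S2S_isomorphic (canonical_topology B) (Ult B) (canonical_topology B') (Ult B'))) \<and>
    (\<forall>(X :: 'x topology) X0 (Y :: 'y topology) Y0. stone_2_space X X0 \<and> stone_2_space Y Y0 \<longrightarrow>
       (S2S_isomorphic X X0 Y Y0 \<longleftrightarrow> ba_isomorphic (RC_pair X X0) (RC_pair Y Y0))) \<and>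
    (\<forall>B :: 'a boolalg. boolean_alg B \<longrightarrow>
       ba_isomorphic (RC_pair (canonical_topology B) (Ult B)) B) \<and>
    (\<forall>(X :: 'x topology) X0. stone_2_space X X0 \<longrightarrow>
       S2S_isomorphic (canonical_topology (RC_pair X X0)) (Ult (RC_pair X X0)) X X0)"
proof (intro conjI allI impI)
  fix B :: "'a boolalg"
  assume B: "boolean_alg B"
  show "ba_iso_map B (RC_pair (canonical_topology B) (Ult B)) (canonical_g B)"
    by (rule boolean_alg.ba_iso_map_canonical_g[OF B])
  show "carrier (RC_pair (canonical_topology B) (Ult B)) = carrier (RC (canonical_topology B))
      \<longleftrightarrow> ba_complete B"
    by (rule boolean_alg.RC_pair_canonical_eq_RC_iff_complete[OF B])
  show "stone_2_space (canonical_topology B) (Ult B)"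
    by (rule boolean_alg.stone_2_space_canonical[OF B])
  show "ba_isomorphic (RC_pair (canonical_topology B) (Ult B)) B"
    by (rule ba_isomorphic_sym[OF B ba_isomorphic_RC_pair_canonical[OF B]])
next
  fix X :: "'x topology" and X0
  assume X: "stone_2_space X X0"
  show "boolean_alg (RC_pair X X0)"
    by (rule stone_2_space_imp_boolean_alg[OF X])
  show "S2S_isomorphic (canonical_topology (RC_pair X X0)) (Ult (RC_pair X X0)) X X0"
    by (rule S2S_isomorphic_sym[OF stone_2_space_imp_subset[OF X]
          S2S_isomorphic_canonical_RC_pair[OF X]])
next
  fix B :: "'a boolalg" and B' :: "'b boolalg"
  assume "boolean_alg B \<and> boolean_alg B'"
  then show "ba_isomorphic B B' \<longleftrightarrow>
      S2S_isomorphic (canonical_topology B) (Ult B) (canonical_topology B') (Ult B')"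
    by (elim conjE) (rule ba_isomorphic_iff_S2S_isomorphic_canonical)
next
  fix X :: "'x topology" and X0 and Y :: "'y topology" and Y0
  assume "stone_2_space X X0 \<and> stone_2_space Y Y0"
  then show "S2S_isomorphic X X0 Y Y0 \<longleftrightarrow> ba_isomorphic (RC_pair X X0) (RC_pair Y Y0)"
    by (elim conjE) (rule S2S_isomorphic_iff_ba_isomorphic_RC_pair)
qed

end
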